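(* Let $k\in\mathbb{N}$ and let $\sigma_k$ be the critical abscissa for the $2k$th moment of the Riemann zeta function (as defined in the context). If $\sigma>\sigma_k$ then the function $t\mapsto\zeta^k(\sigma+it)$ on $[1,\infty]$ belongs to $B^2$.
   Context: $\zeta$ is the Riemann zeta function, and $\zeta^k(s)=(\zeta(s))^k$. For fixed $\sigma\ge 1/2$ and $k\in\mathbb{N}=\{1,2,3,\dots\}$, let $M_k(\sigma,T)=\int_1^T|\zeta(\sigma+it)|^{2k}\,dt$ for $T>1$. $d_k(n)$ is the number of ways of writing the natural number $n$ as an (ordered) product of $k$ factors, so that $\zeta(s)^k=\sum_{n\ge1}d_k(n)n^{-s}$ for $\Re s>1$; $d_k^2(n)$ means $(d_k(n))^2$. It is a known fact (Titchmarsh, The Theory of the Riemann Zeta-Function) that there is a non-decreasing sequence $(\sigma_k)_{k\ge 1}$ with $1/2\le\sigma_k<1$, uniquely determined by the following two properties: (i) $\lim_{T\to\infty}M_k(\sigma,T)/T=\sum_{n=1}^\infty d_k^2(n)n^{-2\sigma}$ for every $\sigma>\sigma_k$; (ii) if $\sigma_k>1/2$, then $\limsup_{T\to\infty}M_k(\sigma,T)/T=\infty$ for every $1/2\le\sigma<\sigma_k$. This is the definition of $\sigma_k$. $[1,\infty]$ denotes the half-line $t\ge1$; $L^2_{\mathrm{loc}}[1,\infty]$ is the set of measurable complex-valued $f$ with $\int_1^T|f|^2dt<\infty$ for every $T>1$. A Bohr (uniformly almost-periodic) function is a uniform limit of finite sums $\sum_j c_je^{i\lambda_jt}$ with $c_j\in\mathbb{C}$,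 $\lambda_j\in\mathbb{R}$. $B^2=B^2[1,\infty]$ is the space of Besicovitch almost-periodic functions: $f\in L^2_{\mathrm{loc}}[1,\infty]$ belongs to $B^2$ if for every $\epsilon>0$ there is a Bohr function $g$ with $\limsup_{T\to\infty}\frac1T\int_1^T|f-g|^2dt<\epsilon$. (Functions $f,h$ with $\lim_{T\to\infty}\frac1T\int_1^T|f-h|^2dt=0$ are identified.) *)

theory Defs
  imports "HOL-Complex_Analysis.Complex_Analysis"
begin

text \<open>The Riemann zeta function, as the analytic continuation of its Dirichlet series to the plane
  punctured at 1. By the identity theorem the value is determined at every point other than the
  pole 1, where it is left unspecified.\<close>

definition zeta :: "complex \<Rightarrow> complex" where
  "zeta = (SOME f. f holomorphic_on (- {1}) \<and>
                   (\<forall>s. Re s > 1 \<longrightarrow> (\<lambda>n. 1 / of_nat (Suc n) powr s) sums f s))"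

definition divisor_fun :: "nat \<Rightarrow> nat \<Rightarrow> nat" where
  "divisor_fun k n = card {xs :: nat list. length xs = k \<and> prod_list xs = n}"

definition zeta_moment :: "nat \<Rightarrow> real \<Rightarrow> real \<Rightarrow> real" where
  "zeta_moment k \<sigma> T = (LINT t:{1..T}|lebesgue. norm (zeta (Complex \<sigma> t)) ^ (2 * k))"

text \<open>The defining property of the sequence of critical abscissae for the moments of zeta. The
  sequence is indexed by positive integers; its value at 0 is irrelevant.\<close>

definition critical_abscissae :: "(nat \<Rightarrow> real) \<Rightarrow> bool" where
  "critical_abscissae \<sigma> \<longleftrightarrow>
     mono_on {1..} \<sigma> \<and>
     (\<forall>k\<ge>1.
        1 / 2 \<le> \<sigma> k \<and> \<sigma> k < 1 \<and>
        (\<forall>x > \<sigma> k. ((\<lambda>T. zeta_moment k x T / T) \<longlongrightarrow>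
            (\<Sum>n. real (divisor_fun k (Suc n)) ^ 2 / real (Suc n) powr (2 * x))) at_top) \<and>
        (\<sigma> k > 1 / 2 \<longrightarrow>
          (\<forall>x. 1 / 2 \<le> x \<and> x < \<sigma> k \<longrightarrow>
             Limsup at_top (\<lambda>T. ereal (zeta_moment k x T / T)) = \<infinity>)))"

lemma critical_abscissae_le:
  assumes "critical_abscissae \<sigma>" "critical_abscissae \<tau>" "k \<ge> 1"
  shows "\<sigma> k \<le> \<tau> k"
proof (rule ccontr)
  assume "\<not> \<sigma> k \<le> \<tau> k"
  then obtain x where x: "\<tau> k < x" "x < \<sigma> k"
    using dense[of "\<tau> k" "\<sigma> k"] by auto
  have "1 / 2 \<le> \<tau> k"
    using assms(2,3) unfolding critical_abscissae_def by blast
  with x have half: "1 / 2 \<le> x" "1 / 2 < \<sigma> k" by linarith+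
  obtain L where "((\<lambda>T. zeta_moment k x T / T) \<longlongrightarrow> L) at_top"
    using assms(2,3) x(1) unfolding critical_abscissae_def by blast
  then have "((\<lambda>T. ereal (zeta_moment k x T / T)) \<longlongrightarrow> ereal L) at_top"
    by simp
  then have "Limsup at_top (\<lambda>T. ereal (zeta_moment k x T / T)) = ereal L"
    by (intro lim_imp_Limsup) auto
  moreover have "Limsup at_top (\<lambda>T. ereal (zeta_moment k x T / T)) = \<infinity>"
    using assms(1,3) x(2) half unfolding critical_abscissae_def by blast
  ultimately show False by simp
qed

lemma critical_abscissae_unique:
  assumes "critical_abscissae \<sigma>" "critical_abscissae \<tau>" "k \<ge> 1"
  shows "\<sigma> k = \<tau> k"
  using critical_abscissae_le[OF assms(1,2,3)] critical_abscissae_le[OF assms(2,1,3)] by simp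

definition trig_polynomial :: "(real \<Rightarrow> complex) \<Rightarrow> bool" where
  "trig_polynomial p \<longleftrightarrow>
     (\<exists>(N :: nat) (c :: nat \<Rightarrow> complex) (freq :: nat \<Rightarrow> real).
        p = (\<lambda>t. \<Sum>j<N. c j * exp (\<i> * complex_of_real (freq j * t))))"

definition bohr :: "(real \<Rightarrow> complex) \<Rightarrow> bool" where
  "bohr g \<longleftrightarrow> (\<exists>p :: nat \<Rightarrow> real \<Rightarrow> complex.
     (\<forall>n. trig_polynomial (p n)) \<and> uniform_limit UNIV p g sequentially)"

definition L2_loc :: "(real \<Rightarrow> complex) set" where
  "L2_loc = {f. set_borel_measurable lebesgue {1..} f \<and>
                (\<forall>T>1. set_integrable lebesgue {1..T} (\<lambda>t. norm (f t) ^ 2))}"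

text \<open>Functions on the half-line are represented by functions on the reals whose values outside
  \<open>{1..}\<close> are irrelevant. Membership is invariant under changing a locally square-integrable
  function by one of mean square zero, so it can be stated for representatives.\<close>

definition besicovitch2 :: "(real \<Rightarrow> complex) set" where
  "besicovitch2 = {f \<in> L2_loc. \<forall>\<epsilon>>0. \<exists>g. bohr g \<and>
     Limsup at_top (\<lambda>T. ereal ((LINT t:{1..T}|lebesgue. norm (f t - g t) ^ 2) / T)) < ereal \<epsilon>}"

end

theory Submission
  imports Defs
begin

text \<open>Let \<open>a n = d\<^sub>k(n) n\<^sup>-\<^sup>\<sigma>\<close>. Once the Fourier-Bohr coefficient of \<open>t \<mapsto> \<zeta>(\<sigma> + it)\<^sup>k\<close> at frequency
  \<open>- log n\<close> is known to be \<open>a n\<close>, the mean square of \<open>\<zeta>(\<sigma> + it)\<^sup>k - (\<Sum>n\<le>N. a n * n\<^sup>-\<^sup>i\<^sup>t)\<close> is \<open>L - (\<Sum>n\<le>N. (a n)\<^sup>2)\<close>, where \<open>L\<close> is the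
  mean square of \<open>\<zeta>(\<sigma> + it)\<^sup>k\<close>. This tends to 0, because \<open>L = (\<Sum>n. (a n)\<^sup>2)\<close> by the choice of \<open>\<sigma>\<close>.

  To find the coefficients, the mean value of \<open>\<zeta>(s)\<^sup>k n\<^sup>s\<close> is moved from \<open>Re s = \<sigma>\<close> to \<open>Re s = \<sigma> + 1\<close>, where the
  Dirichlet series converges absolutely. On the horizontal segment at height \<open>T\<close> only \<open>\<zeta>(s) = O(T)\<close> is
  available, so the integrand is first multiplied by the polynomial weight \<open>(1 - u\<^sup>N)\<^sup>k\<close> with \<open>u = (s - \<sigma>) / (iT)\<close>,
  which is \<open>O(T\<^sup>-\<^sup>k)\<close> there. Because \<open>\<zeta>\<^sup>k\<close> has bounded mean square, the weight costs an error that tends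
  to 0 as \<open>N\<close> grows.\<close>

subsection \<open>Analytic continuation and growth of the zeta function\<close>

lemma has_field_derivative_powr_falling:
  fixes a z :: complex
  assumes "z \<notin> \<real>\<^sub>\<le>\<^sub>0"
  shows "((\<lambda>z. (\<Prod>l<i. a - of_nat l) * z powr (a - of_nat i)) has_field_derivative
           (\<Prod>l<Suc i. a - of_nat l) * z powr (a - of_nat (Suc i))) (at z within S)"
proof -
  have "((\<lambda>z. (\<Prod>l<i. a - of_nat l) * z powr (a - of_nat i)) has_field_derivative
           (\<Prod>l<i. a - of_nat l) * ((a - of_nat i) * z powr (a - of_nat i - 1))) (at z within S)"
    by (intro DERIV_cmult has_field_derivative_at_within[OF has_field_derivative_powr] assms)
  then show ?thesis by (simp add: algebra_simps)
qed

text \<open>The error at \<open>n + 2\<close> of the Taylor polynomial of degree \<open>M\<close>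
  about \<open>n + 1\<close> for the power with exponent \<open>1 - s\<close>: its
  \<open>j\<close>-th derivative over \<open>j!\<close> is a generalised binomial coefficient times
  a power. The base point is \<open>Suc n\<close> so that indices start at 0.\<close>

definition zeta_rest :: "nat \<Rightarrow> complex \<Rightarrow> nat \<Rightarrow> complex" where
  "zeta_rest M s n = of_nat (n + 2) powr (1 - s)
     - (\<Sum>j\<le>M. ((1 - s) gchoose j) * of_nat (Suc n) powr (1 - s - of_nat j))"

text \<open>Taylor's theorem on the segment from \<open>n + 1\<close> to \<open>n + 2\<close>. The
  derivative of order \<open>M + 1\<close> has exponent with real part \<open>- (Re s + M)\<close>,
  which is not positive, so its modulus is largest at the left endpoint.\<close>

lemma norm_zeta_rest_le:
  assumes "Re s + M \<ge> 0"
  shows "norm (zeta_rest M s n) \<le> norm (\<Prod>l<Suc M. 1 - s - of_nat l) * real (Suc n) powr (- (Re s + M))"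
proof -
  define S where "S = closed_segment (of_nat (Suc n)) (of_nat (n + 2) :: complex)"
  define f where "f = (\<lambda>i z. (\<Prod>l<i. 1 - s - of_nat l) * z powr (1 - s - of_nat i :: complex))"
  define B where "B = norm (\<Prod>l<Suc M. 1 - s - of_nat l) * real (Suc n) powr (- (Re s + M))"
  have S: "\<exists>x. z = of_real x \<and> x \<ge> real (Suc n)" if "z \<in> S" for z
  proof -
    have "S = of_real ` closed_segment (real (Suc n)) (real (n + 2))"
      unfolding S_def using closed_segment_of_real[of "real (Suc n)" "real (n + 2)"]
      by (simp only: of_real_of_nat_eq)
    with that obtain x where "z = of_real x" "x \<in> closed_segment (real (Suc n)) (real (n + 2))"
      by blast
    then show ?thesis by (auto simp: closed_segment_eq_real_ivl)
  qed
  have "norm (f 0 (of_nat (n + 2)) - (\<Sum>i\<le>M. f i (of_nat (Suc n)) * (of_nat (n + 2) - of_nat (Suc n)) ^ i / fact i))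
     \<le> B * norm (of_nat (n + 2) - of_nat (Suc n) :: complex) ^ Suc M / fact M"
  proof (rule complex_Taylor[where S = S])
    show "convex S" by (simp add: S_def)
    show "of_nat (Suc n) \<in> S" "of_nat (n + 2) \<in> S" by (simp_all only: S_def ends_in_segment)
    fix i z assume "z \<in> S" "i \<le> M"
    then have "z \<notin> \<real>\<^sub>\<le>\<^sub>0" using S[of z] by auto
    then show "(f i has_field_derivative f (Suc i) z) (at z within S)"
      unfolding f_def by (rule has_field_derivative_powr_falling)
  next
    fix z assume "z \<in> S"
    then obtain x where x: "z = of_real x" "x \<ge> real (Suc n)" using S by blast
    have "norm (z powr (1 - s - of_nat (Suc M))) = x powr (- (Re s + M))"
      using x by (subst norm_powr_real_powr) (auto simp: algebra_simps)
    also have "\<dots> \<le> real (Suc n) powr (- (Re s + M))"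
      using x assms by (intro powr_mono2') auto
    finally show "norm (f (Suc M) z) \<le> B"
      unfolding f_def B_def norm_mult by (intro mult_left_mono) auto
  qed
  moreover have "f 0 (of_nat (n + 2)) - (\<Sum>i\<le>M. f i (of_nat (Suc n)) * (of_nat (n + 2) - of_nat (Suc n)) ^ i / fact i)
     = zeta_rest M s n"
    unfolding zeta_rest_def f_def gbinomial_prod_rev atLeast0LessThan by (simp add: algebra_simps)
  moreover have "of_nat (n + 2) - of_nat (Suc n) = (1 :: complex)" by simp
  ultimately have "norm (zeta_rest M s n) \<le> B / fact M" by simp
  also have "\<dots> \<le> B / 1"
    by (intro divide_left_mono) (auto simp: B_def intro: fact_ge_1)
  finally show ?thesis by (simp add: B_def)
qed

lemma summable_Suc_powr:
  assumes "a > 1"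
  shows "summable (\<lambda>n. real (Suc n) powr - a)"
  using summable_real_powr_iff[of "-a"] assms
  by (subst summable_Suc_iff[where f = "\<lambda>n. real n powr - a"]) auto

lemma holomorphic_gbinomial [holomorphic_intros]:
  assumes "f holomorphic_on S"
  shows "(\<lambda>s. (f s :: complex) gchoose j) holomorphic_on S"
  unfolding gbinomial_prod_rev by (intro holomorphic_intros assms) simp

lemma holomorphic_zeta_rest: "(\<lambda>s. zeta_rest M s n) holomorphic_on S"
  unfolding zeta_rest_def by (intro holomorphic_intros)

text \<open>In this half-plane \<open>Re s + M > 1\<close>, so the bound on a single remainder is
  summable, and locally uniformly so.\<close>

lemma holomorphic_suminf_zeta_rest:
  "(\<lambda>s. \<Sum>n. zeta_rest M s n) holomorphic_on {s. Re s > 1 - real M}"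
proof (rule holomorphic_uniform_sequence)
  show "open {s. Re s > 1 - real M}" by (rule open_halfspace_Re_gt)
  show "\<And>N. (\<lambda>s. \<Sum>n<N. zeta_rest M s n) holomorphic_on {s. Re s > 1 - real M}"
    by (intro holomorphic_intros holomorphic_zeta_rest)
  fix x assume x: "x \<in> {s. Re s > 1 - real M}"
  \<comment> \<open>Half the distance to the boundary line: on the closed ball of this radius
    \<open>Re s + M\<close> is still at least \<open>1 + d\<close>.\<close>
  define d where "d = (Re x - (1 - real M)) / 2"
  have d: "d > 0" using x by (simp add: d_def)
  have Re_le: "\<bar>Re s - Re x\<bar> \<le> d" if "s \<in> cball x d" for s
    using abs_Re_le_cmod[of "s - x"] that by (auto simp: dist_norm norm_minus_commute)
  have "bounded ((\<lambda>s. \<Prod>l<Suc M. 1 - s - of_nat l) ` cball x d)"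
    by (intro compact_imp_bounded compact_continuous_image continuous_intros) auto
  then obtain B where B: "\<And>s. s \<in> cball x d \<Longrightarrow> norm (\<Prod>l<Suc M. 1 - s - of_nat l) \<le> B"
    unfolding bounded_iff by blast
  have "uniform_limit (cball x d) (\<lambda>N s. \<Sum>n<N. zeta_rest M s n) (\<lambda>s. \<Sum>n. zeta_rest M s n) sequentially"
  proof (rule Weierstrass_m_test)
    show "summable (\<lambda>n. B * real (Suc n) powr - (1 + d))"
      using d by (intro summable_mult summable_Suc_powr) auto
    fix n s assume s: "s \<in> cball x d"
    have *: "Re s + M \<ge> 1 + d" using abs_le_D2[OF Re_le[OF s]] unfolding d_def by argo
    have "norm (zeta_rest M s n) \<le> norm (\<Prod>l<Suc M. 1 - s - of_nat l) * real (Suc n) powr (- (Re s + M))"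
      using * d by (intro norm_zeta_rest_le) auto
    also have "\<dots> \<le> B * real (Suc n) powr - (1 + d)"
      using B[OF s] * by (intro mult_mono powr_mono) (auto intro: order.trans[OF norm_ge_zero])
    finally show "norm (zeta_rest M s n) \<le> B * real (Suc n) powr - (1 + d)" .
  qed
  moreover have "cball x d \<subseteq> {s. Re s > 1 - real M}"
  proof
    fix s assume "s \<in> cball x d"
    from abs_le_D2[OF Re_le[OF this]] d show "s \<in> {s. Re s > 1 - real M}"
      unfolding d_def mem_Collect_eq by argo
  qed
  ultimately show "\<exists>d. 0 < d \<and> cball x d \<subseteq> {s. Re s > 1 - real M} \<and>
      uniform_limit (cball x d) (\<lambda>N s. \<Sum>n<N. zeta_rest M s n) (\<lambda>s. \<Sum>n. zeta_rest M s n) sequentially"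
    using d by blast
qed

section \<open>The Dirichlet series and its continuation strip by strip\<close>

definition zeta_dirichlet :: "complex \<Rightarrow> complex" where
  "zeta_dirichlet s = (\<Sum>n. 1 / of_nat (Suc n) powr s)"

lemma norm_dirichlet_term: "norm (1 / of_nat (Suc n) powr s) = real (Suc n) powr - Re s"
  by (simp add: norm_divide norm_powr_real_powr powr_minus_divide)

lemma zeta_dirichlet_sums:
  assumes "Re s > 1"
  shows "(\<lambda>n. 1 / of_nat (Suc n) powr s) sums zeta_dirichlet s"
  unfolding zeta_dirichlet_def
  by (intro summable_sums summable_norm_cancel[where f = "\<lambda>n. 1 / of_nat (Suc n) powr s"])
     (use summable_Suc_powr[OF assms] in \<open>simp only: norm_dirichlet_term\<close>)

text \<open>Sum the Taylor expansion of \<open>(n + 1)\<^sup>1\<^sup>-\<^sup>s\<close> around \<open>n\<close> over all \<open>n\<close>; the left-hand side telescopes.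
  Since the remainder converges for \<open>Re s > 1 - M\<close>, this continues \<open>\<zeta>\<close> strip by strip.\<close>

lemma zeta_dirichlet_recursion:
  assumes s: "Re s > 1" and M: "M \<ge> 1"
  shows "(s - 1) * zeta_dirichlet s =
    1 + (\<Sum>j=2..M. ((1 - s) gchoose j) * zeta_dirichlet (s + of_nat j - 1)) + (\<Sum>n. zeta_rest M s n)"
proof -
  have "((\<lambda>n. real (Suc n) powr - (Re s - 1)) \<longlongrightarrow> 0) sequentially"
    using s by real_asymp
  then have "((\<lambda>n. of_nat (Suc n) powr (1 - s)) \<longlongrightarrow> (0 :: complex)) sequentially"
    by (subst tendsto_norm_zero_iff [symmetric]) (simp add: norm_powr_real_powr)
  from telescope_sums[OF this]
  have tel: "(\<lambda>n. of_nat (n + 2) powr (1 - s) - of_nat (Suc n) powr (1 - s)) sums (-1 :: complex)"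
    by simp
  have dir: "(\<lambda>n. ((1 - s) gchoose j) * of_nat (Suc n) powr (1 - s - of_nat j)) sums
      (((1 - s) gchoose j) * zeta_dirichlet (s + of_nat j - 1))" if "j \<ge> 1" for j
  proof -
    have "Re (s + of_nat j - 1) > 1" using s that by (simp add: Re_divide)
    from zeta_dirichlet_sums[OF this] show ?thesis
      by (intro sums_mult) (simp add: powr_minus_divide [symmetric] algebra_simps)
  qed
  have "(\<lambda>n. (of_nat (n + 2) powr (1 - s) - of_nat (Suc n) powr (1 - s)) -
          (\<Sum>j=1..M. ((1 - s) gchoose j) * of_nat (Suc n) powr (1 - s - of_nat j)))
     sums (-1 - (\<Sum>j=1..M. ((1 - s) gchoose j) * zeta_dirichlet (s + of_nat j - 1)))"
    by (intro sums_diff tel sums_sum dir) auto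
  also have "(\<lambda>n. (of_nat (n + 2) powr (1 - s) - of_nat (Suc n) powr (1 - s)) -
          (\<Sum>j=1..M. ((1 - s) gchoose j) * of_nat (Suc n) powr (1 - s - of_nat j))) = zeta_rest M s"
  proof
    fix n
    have "{..M} = insert 0 {1..M}" by auto
    then show "(of_nat (n + 2) powr (1 - s) - of_nat (Suc n) powr (1 - s)) -
          (\<Sum>j=1..M. ((1 - s) gchoose j) * of_nat (Suc n) powr (1 - s - of_nat j)) = zeta_rest M s n"
      by (simp add: zeta_rest_def)
  qed
  finally have "(\<Sum>n. zeta_rest M s n) = -1 - (\<Sum>j=1..M. ((1 - s) gchoose j) * zeta_dirichlet (s + of_nat j - 1))"
    by (rule sums_unique [symmetric])
  \<comment> \<open>The term \<open>j = 1\<close> is \<open>(1 - s) * zeta_dirichlet s\<close>;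
    moved to the other side it becomes the left-hand side of the claim.\<close>
  moreover have "{1..M} = insert 1 {2..M}" using M by auto
  ultimately show ?thesis by (simp add: algebra_simps)
qed

text \<open>The factor \<open>s - 1\<close> cancels the pole, so continuation takes place on full
  half-planes without a puncture.\<close>

definition is_zeta_reg :: "real \<Rightarrow> (complex \<Rightarrow> complex) \<Rightarrow> bool" where
  "is_zeta_reg a h \<longleftrightarrow> h holomorphic_on {s. Re s > a} \<and>
     (\<forall>s. Re s > 1 \<longrightarrow> h s = (s - 1) * zeta_dirichlet s)"

text \<open>For \<open>j \<ge> 2\<close> the recursion evaluates zeta at \<open>s + j - 1\<close>,
  at least one unit further right, where \<open>h\<close> is already holomorphic. The last factor
  \<open>- (s + j - 2)\<close> of the falling factorial in \<open>(1 - s) gchoose j\<close> is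
  exactly what turns zeta there into \<open>h\<close>, so no pole enters. For \<open>M = 1\<close>
  the sum is empty, which starts the induction.\<close>

lemma is_zeta_reg_step:
  assumes M: "M \<ge> 1" and h: "M = 1 \<or> is_zeta_reg (2 - real M) h"
  shows "is_zeta_reg (1 - real M) (\<lambda>s. 1 - (\<Sum>j=2..M. ((1 - s) gchoose (j - 1)) / of_nat j * h (s + of_nat (j - 1)))
            + (\<Sum>n. zeta_rest M s n))"
  unfolding is_zeta_reg_def
proof safe
  have "(\<lambda>s. h (s + of_nat (j - 1))) holomorphic_on {s. Re s > 1 - real M}" if j: "j \<in> {2..M}" for j
  proof -
    have "h holomorphic_on {s. Re s > 2 - real M}" using h j by (auto simp: is_zeta_reg_def)
    then have "(h \<circ> (\<lambda>s. s + of_nat (j - 1))) holomorphic_on {s. Re s > 1 - real M}"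
      by (rule holomorphic_on_compose_gen[rotated]) (use j in \<open>auto intro!: holomorphic_intros\<close>)
    then show ?thesis by (simp add: o_def)
  qed
  then show "(\<lambda>s. 1 - (\<Sum>j=2..M. ((1 - s) gchoose (j - 1)) / of_nat j * h (s + of_nat (j - 1)))
            + (\<Sum>n. zeta_rest M s n)) holomorphic_on {s. Re s > 1 - real M}"
    by (intro holomorphic_intros holomorphic_suminf_zeta_rest) auto
next
  fix s :: complex assume s: "Re s > 1"
  have "- (((1 - s) gchoose (j - 1)) / of_nat j * h (s + of_nat (j - 1))) =
        ((1 - s) gchoose j) * zeta_dirichlet (s + of_nat j - 1)" if j: "j \<in> {2..M}" for j
  proof -
    obtain i where i: "j = Suc i" using j by (cases j) auto
    have "h (s + of_nat i) = (s + of_nat i - 1) * zeta_dirichlet (s + of_nat i)"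
      using h j s i by (auto simp: is_zeta_reg_def)
    moreover have "(1 - s) gchoose j = - (((1 - s) gchoose i) / of_nat j * (s + of_nat i - 1))"
      by (simp add: i gbinomial_prod_rev atLeast0LessThan field_simps del: of_nat_Suc)
    moreover have "s + of_nat j - 1 = s + of_nat i" "j - 1 = i" by (simp_all add: i)
    ultimately show ?thesis by (simp only: mult_minus_left mult.assoc)
  qed
  then have "- (\<Sum>j=2..M. ((1 - s) gchoose (j - 1)) / of_nat j * h (s + of_nat (j - 1))) =
      (\<Sum>j=2..M. ((1 - s) gchoose j) * zeta_dirichlet (s + of_nat j - 1))"
    unfolding sum_negf [symmetric] by (intro sum.cong) auto
  then show "1 - (\<Sum>j=2..M. ((1 - s) gchoose (j - 1)) / of_nat j * h (s + of_nat (j - 1)))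
      + (\<Sum>n. zeta_rest M s n) = (s - 1) * zeta_dirichlet s"
    unfolding zeta_dirichlet_recursion[OF s M] by (simp only: diff_conv_add_uminus)
qed

lemma is_zeta_reg_1: "is_zeta_reg 0 (\<lambda>s. 1 + (\<Sum>n. zeta_rest 1 s n))"
  using is_zeta_reg_step[of 1] by simp

lemma is_zeta_reg_exists: "\<exists>h. is_zeta_reg (- real m) h"
proof (induction m)
  case 0
  then show ?case using is_zeta_reg_1 by auto
next
  case (Suc m)
  then obtain h where "is_zeta_reg (- real m) h" by blast
  \<comment> \<open>With \<open>M = m + 2\<close> the step leads from \<open>Re s > - m\<close> to
    \<open>Re s > - (m + 1)\<close>.\<close>
  then have "is_zeta_reg (2 - real (m + 2)) h" by simp
  from is_zeta_reg_step[OF _ disjI2, OF _ this] show ?case by auto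
qed

lemma is_zeta_reg_unique:
  assumes "is_zeta_reg a g" "is_zeta_reg b h" "Re s > a" "Re s > b" 
  shows "g s = h s"
proof (cases "Re s > 1")
  case True
  with assms show ?thesis by (simp add: is_zeta_reg_def)
next
  case False
  define c where "c = max a b"
  show ?thesis
  proof (rule analytic_continuation_open[where f = g and g = h and s = "{s. Re s > 1}" and s' = "{s. Re s > c}"])
    show "{s. Re s > 1} \<noteq> {}" by (auto intro!: exI[of _ 2])
    show "connected {s. Re s > c}" by (intro convex_connected convex_halfspace_Re_gt)
    show "{s. Re s > 1} \<subseteq> {s. Re s > c}" using False assms by (auto simp: c_def)
    show "open {s. Re s > c}" by (rule open_halfspace_Re_gt)
    show "g holomorphic_on {s. Re s > c}" "h holomorphic_on {s. Re s > c}"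
      using assms unfolding is_zeta_reg_def c_def
      by (auto elim!: holomorphic_on_subset)
  qed (use assms in \<open>auto simp: open_halfspace_Re_gt is_zeta_reg_def c_def\<close>)
qed

text \<open>This makes the choice in the definition of \<open>zeta\<close> meaningful. The
  continuations to half-planes agree on overlaps, hence glue to an entire function, and dividing by
  \<open>s - 1\<close> gives zeta.\<close>

lemma zeta_continuation_exists:
  "\<exists>f. f holomorphic_on (- {1}) \<and> (\<forall>s. Re s > 1 \<longrightarrow> (\<lambda>n. 1 / of_nat (Suc n) powr s) sums f s)"
proof -
  obtain h where h: "\<And>m. is_zeta_reg (- real m) (h m)"
    using is_zeta_reg_exists by metis
  \<comment> \<open>At each \<open>s\<close> the index is large enough for the half-plane to contain
    \<open>s\<close> strictly; by uniqueness every other admissible index gives the same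
    value.\<close>
  define H where "H = (\<lambda>s. h (nat \<lceil>- Re s\<rceil> + 1) s)"
  have H: "H s = h m s" if "Re s > - real m" for m s
    unfolding H_def by (rule is_zeta_reg_unique[OF h h]) (use that in linarith)+
  have "H holomorphic_on {s. Re s > - real m}" for m
    using h[of m] H[of m] holomorphic_cong[of "{s. Re s > - real m}" _ H "h m"]
    by (simp add: is_zeta_reg_def)
  then have "H holomorphic_on (\<Union>m. {s. Re s > - real m})"
    by (intro holomorphic_on_UN_open) (auto intro: open_halfspace_Re_gt)
  also have "(\<Union>m. {s. Re s > - real m}) = UNIV"
  proof -
    have "\<exists>m. Re s > - real m" for s using reals_Archimedean2[of "- Re s"] by (auto simp: minus_less_iff)
    then show ?thesis by auto
  qed
  finally have "H holomorphic_on UNIV" .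
  then have "(\<lambda>s. H s / (s - 1)) holomorphic_on (- {1})"
    by (auto intro!: holomorphic_intros elim: holomorphic_on_subset)
  moreover have "(\<lambda>n. 1 / of_nat (Suc n) powr s) sums (H s / (s - 1))" if "Re s > 1" for s
  proof -
    have "H s = (s - 1) * zeta_dirichlet s" 
      using H[of 0 s] h[of 0] that by (auto simp: is_zeta_reg_def)
    moreover have "s \<noteq> 1" using that by auto
    ultimately show ?thesis using zeta_dirichlet_sums[OF that] by simp
  qed
  ultimately show ?thesis by blast
qed

section \<open>Consequences for \<open>zeta\<close> and linear growth in a half-plane\<close>

lemma holomorphic_zeta: "zeta holomorphic_on (- {1})"
  and zeta_sums: "Re s > 1 \<Longrightarrow> (\<lambda>n. 1 / of_nat (Suc n) powr s) sums zeta s"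
  using someI_ex[OF zeta_continuation_exists] unfolding zeta_def [symmetric] by blast+

text \<open>The case \<open>M = 1\<close> of the recursion, carried to \<open>Re s > 0\<close> by
  the identity theorem; the half-plane stays connected when the point 1 is removed.\<close>

lemma zeta_eq_rest:
  assumes "Re s > 0" "s \<noteq> 1"
  shows "(s - 1) * zeta s = 1 + (\<Sum>n. zeta_rest 1 s n)"
proof (rule analytic_continuation_open[where f = "\<lambda>s. (s - 1) * zeta s" and g = "\<lambda>s. 1 + (\<Sum>n. zeta_rest 1 s n)"
      and s = "{s. Re s > 1}" and s' = "{s. Re s > 0} - {1}"])
  show "{s. Re s > 1} \<noteq> {}" by (auto intro!: exI[of _ 2])
  show "connected ({s. Re s > 0} - {1})"
    by (intro connected_open_delete convex_connected convex_halfspace_Re_gt open_halfspace_Re_gt) auto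
  show "(\<lambda>s. (s - 1) * zeta s) holomorphic_on {s. Re s > 0} - {1}"
    by (intro holomorphic_intros holomorphic_on_subset[OF holomorphic_zeta]) auto
  show "(\<lambda>s. 1 + (\<Sum>n. zeta_rest 1 s n)) holomorphic_on {s. Re s > 0} - {1}"
    using is_zeta_reg_1 by (auto simp: is_zeta_reg_def elim: holomorphic_on_subset)
  fix z :: complex assume "z \<in> {s. Re s > 1}"
  then have z: "Re z > 1" by simp
  then have "zeta_dirichlet z = zeta z"
    using sums_unique2[OF zeta_dirichlet_sums[OF z] zeta_sums[OF z]] by simp
  then show "(z - 1) * zeta z = 1 + (\<Sum>n. zeta_rest 1 z n)"
    using is_zeta_reg_1 z by (auto simp: is_zeta_reg_def)
qed (use assms in \<open>auto simp: open_halfspace_Re_gt intro!: open_delete\<close>)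

text \<open>The remainder bound for \<open>M = 1\<close> carries the factor
  \<open>|s (s - 1)|\<close>, and dividing by \<open>|s - 1|\<close> leaves \<open>|s|\<close>. The
  condition \<open>Im s \<ge> 1\<close> gives \<open>|s| \<ge> 1\<close> and
  \<open>|s - 1| \<ge> 1\<close>, which absorbs the constant term.\<close>

lemma zeta_linear_growth:
  assumes "\<sigma> > 0"
  shows "\<exists>K>0. \<forall>s. Re s \<ge> \<sigma> \<longrightarrow> Im s \<ge> 1 \<longrightarrow> norm (zeta s) \<le> K * norm s"
proof (intro exI conjI allI impI)
  define Z where "Z = (\<Sum>n. real (Suc n) powr - (\<sigma> + 1))"
  have sm: "summable (\<lambda>n. real (Suc n) powr - (\<sigma> + 1))"
    by (rule summable_Suc_powr) (use assms in auto)
  show "1 + Z > 0" unfolding Z_def by (intro add_pos_nonneg suminf_nonneg sm) auto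
  fix s assume s: "Re s \<ge> \<sigma>" "Im s \<ge> 1"
  then have ne: "s \<noteq> 1" "Re s > 0" using assms by auto
  have bd: "norm (zeta_rest 1 s n) \<le> norm (s * (s - 1)) * real (Suc n) powr - (\<sigma> + 1)" for n
  proof -
    have "norm (zeta_rest 1 s n) \<le> norm (\<Prod>l<Suc 1. 1 - s - of_nat l) * real (Suc n) powr (- (Re s + 1))"
      using norm_zeta_rest_le[of s 1 n] ne by simp
    also have "(\<Prod>l<Suc 1. 1 - s - of_nat l) = s * (s - 1)" by (simp add: algebra_simps)
    finally show ?thesis
      using s by (elim order.trans) (auto intro!: mult_left_mono powr_mono)
  qed
  have "norm (\<Sum>n. zeta_rest 1 s n) \<le> (\<Sum>n. norm (s * (s - 1)) * real (Suc n) powr - (\<sigma> + 1))"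
    by (intro norm_suminf_le bd summable_mult sm)
  also have "\<dots> = norm (s * (s - 1)) * Z"
    unfolding Z_def by (rule suminf_mult[OF sm])
  finally have R: "norm (\<Sum>n. zeta_rest 1 s n) \<le> norm (s * (s - 1)) * Z" .
  have one: "1 \<le> norm s" "1 \<le> norm (s - 1)"
    using abs_Im_le_cmod[of s] abs_Im_le_cmod[of "s - 1"] s by auto
  have "norm (s - 1) * norm (zeta s) \<le> 1 + norm (\<Sum>n. zeta_rest 1 s n)"
    unfolding norm_mult [symmetric] zeta_eq_rest[OF ne(2,1)] by (rule norm_triangle_le) simp
  also have "\<dots> \<le> norm s * norm (s - 1) + norm (s * (s - 1)) * Z"
    using R one mult_mono[of 1 "norm s" 1 "norm (s - 1)"] by (intro add_mono) auto
  also have "\<dots> = norm (s - 1) * ((1 + Z) * norm s)"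
    unfolding norm_mult by algebra
  finally show "norm (zeta s) \<le> (1 + Z) * norm s"
    using one by (auto simp: mult_le_cancel_left)
qed

subsection \<open>Mean values\<close>

text \<open>Continuity is included so that all integrals over \<open>{1..T}\<close> exist and the
  linear rules carry no integrability conditions.\<close>

definition has_mean :: "(real \<Rightarrow> complex) \<Rightarrow> complex \<Rightarrow> bool" where
  "has_mean f L \<longleftrightarrow> continuous_on {1..} f \<and> ((\<lambda>T. integral {1..T} f / of_real T) \<longlongrightarrow> L) at_top"

lemma integrable_on_half_line:
  fixes f :: "real \<Rightarrow> 'a :: euclidean_space"
  assumes "continuous_on {1..} f"
  shows "f integrable_on {1..T}"
  by (intro integrable_continuous_real continuous_on_subset[OF assms]) auto

lemma has_meanD:
  assumes "has_mean f L"
  shows "continuous_on {1..} f" "f integrable_on {1..T}"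
  using assms integrable_on_half_line by (auto simp: has_mean_def)

lemma has_mean_cmult:
  assumes "has_mean f L"
  shows "has_mean (\<lambda>t. c * f t) (c * L)"
proof -
  have "((\<lambda>T. c * (integral {1..T} f / of_real T)) \<longlongrightarrow> c * L) at_top"
    using assms by (intro tendsto_intros) (auto simp: has_mean_def)
  moreover have "integral {1..T} (\<lambda>t. c * f t) = c * integral {1..T} f" for T
    by (rule integral_mult_right)
  ultimately show ?thesis
    using assms by (auto simp: has_mean_def intro!: continuous_intros)
qed

lemma has_mean_add:
  assumes "has_mean f L" "has_mean g M"
  shows "has_mean (\<lambda>t. f t + g t) (L + M)"
proof -
  have "((\<lambda>T. integral {1..T} f / of_real T + integral {1..T} g / of_real T) \<longlongrightarrow> L + M) at_top"
    using assms by (intro tendsto_intros) (auto simp: has_mean_def)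
  moreover have "integral {1..T} (\<lambda>t. f t + g t) = integral {1..T} f + integral {1..T} g" for T
    using assms by (intro integral_add has_meanD)
  ultimately show ?thesis
    using assms by (auto simp: has_mean_def add_divide_distrib intro!: continuous_intros)
qed

lemma has_mean_diff:
  assumes "has_mean f L" "has_mean g M"
  shows "has_mean (\<lambda>t. f t - g t) (L - M)"
  using has_mean_add[OF assms(1) has_mean_cmult[OF assms(2), of "-1"]] by simp

lemma has_mean_sum:
  assumes "\<And>j. j \<in> I \<Longrightarrow> has_mean (f j) (L j)"
  shows "has_mean (\<lambda>t. \<Sum>j\<in>I. f j t) (\<Sum>j\<in>I. L j)"
  using assms
proof (induction I rule: infinite_finite_induct)
  case (insert j I)
  then show ?case by (simp add: has_mean_add)
qed (auto simp: has_mean_def)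

lemma has_mean_cnj:
  assumes "has_mean f L"
  shows "has_mean (\<lambda>t. cnj (f t)) (cnj L)"
proof -
  have "((\<lambda>T. cnj (integral {1..T} f / of_real T)) \<longlongrightarrow> cnj L) at_top"
    using assms by (intro tendsto_intros) (auto simp: has_mean_def)
  moreover have "integral {1..T} (\<lambda>t. cnj (f t)) = cnj (integral {1..T} f)" for T
    by (rule integral_cnj [symmetric])
  ultimately show ?thesis
    using assms by (auto simp: has_mean_def intro!: continuous_intros)
qed

text \<open>Orthogonality of characters: for \<open>w \<noteq> 0\<close> the integrals are bounded
  by \<open>2 / |w|\<close>, so division by \<open>T\<close> sends them to 0.\<close>

lemma has_mean_exp:
  "has_mean (\<lambda>t. exp (\<i> * of_real (w * t))) (if w = 0 then 1 else 0)"
proof (cases "w = 0")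
  case True
  have "((\<lambda>T::real. (T - 1) / T) \<longlongrightarrow> 1) at_top" by real_asymp
  from tendsto_of_real[OF this]
  have "((\<lambda>T. of_real ((T - 1) / T)) \<longlongrightarrow> (1 :: complex)) at_top" by (simp only: of_real_1)
  moreover have "\<forall>\<^sub>F T in at_top. of_real ((T - 1) / T) = (integral {1..T} (\<lambda>_. 1) / of_real T :: complex)"
    using eventually_ge_at_top[of 1] by eventually_elim (simp add: scaleR_conv_of_real)
  ultimately have "((\<lambda>T. integral {1..T} (\<lambda>_. 1) / of_real T) \<longlongrightarrow> (1 :: complex)) at_top"
    by (rule Lim_transform_eventually)
  with True show ?thesis by (simp add: has_mean_def)
next
  case False
  define e where "e = (\<lambda>t::real. exp (\<i> * of_real (w * t)))"
  have ne: "norm (e t) = 1" for t by (simp add: e_def)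
  have der: "((\<lambda>t. e t / (\<i> * of_real w)) has_vector_derivative e t) (at t within S)" for t S
  proof -
    have "((\<lambda>z. exp (\<i> * of_real w * z) / (\<i> * of_real w)) has_field_derivative
             exp (\<i> * of_real w * of_real t)) (at (of_real t))"
      using False by (auto intro!: derivative_eq_intros)
    from has_vector_derivative_real_field[OF this] show ?thesis by (simp add: e_def mult.assoc)
  qed
  have int: "integral {1..T} e = (e T - e 1) / (\<i> * of_real w)" if "T \<ge> 1" for T
    using fundamental_theorem_of_calculus[OF that der] by (simp add: integral_unique diff_divide_distrib)
  have "((\<lambda>T. integral {1..T} e / of_real T) \<longlongrightarrow> 0) at_top"
  proof (rule Lim_null_comparison)
    show "((\<lambda>T. 2 / \<bar>w\<bar> / T) \<longlongrightarrow> 0) at_top" using False by real_asymp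
    show "\<forall>\<^sub>F T in at_top. norm (integral {1..T} e / of_real T) \<le> 2 / \<bar>w\<bar> / T"
      using eventually_ge_at_top[of 1]
    proof eventually_elim
      case (elim T)
      have "norm (e T - e 1) \<le> 2" using norm_triangle_ineq4[of "e T" "e 1"] ne by simp
      then show ?case using elim int[OF elim]
        by (auto simp: norm_divide norm_mult intro!: divide_right_mono)
    qed
  qed
  then show ?thesis unfolding e_def using False by (auto simp: has_mean_def intro!: continuous_intros)
qed

text \<open>Only the integrals are compared, not the functions pointwise; this suits comparison
  functions on another vertical line.\<close>

lemma has_mean_approx:
  assumes f: "continuous_on {1..} f"
    and appr: "\<And>\<epsilon>. \<epsilon> > 0 \<Longrightarrow> \<exists>g. has_mean g L \<and>
        (\<forall>\<^sub>F T in at_top. norm (integral {1..T} f - integral {1..T} g) \<le> \<epsilon> * T)"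
  shows "has_mean f L"
proof -
  have "((\<lambda>T. integral {1..T} f / of_real T) \<longlongrightarrow> L) at_top"
  proof (rule tendstoI)
    fix \<epsilon> :: real assume "\<epsilon> > 0"
    then obtain g where g: "has_mean g L"
      and d: "\<forall>\<^sub>F T in at_top. norm (integral {1..T} f - integral {1..T} g) \<le> \<epsilon> / 2 * T"
      using appr[of "\<epsilon> / 2"] by auto
    have "\<forall>\<^sub>F T in at_top. dist (integral {1..T} g / of_real T) L < \<epsilon> / 2"
      using g \<open>\<epsilon> > 0\<close> by (intro tendstoD) (auto simp: has_mean_def)
    with d eventually_gt_at_top[of 0]
    show "\<forall>\<^sub>F T in at_top. dist (integral {1..T} f / of_real T) L < \<epsilon>"
    proof eventually_elim
      case (elim T)
      have "dist (integral {1..T} f / of_real T) (integral {1..T} g / of_real T) =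
              norm (integral {1..T} f - integral {1..T} g) / T"
        using elim(2) by (simp add: dist_norm diff_divide_distrib [symmetric] norm_divide)
      also have "\<dots> \<le> \<epsilon> / 2" using elim(1,2) by (simp add: field_simps)
      finally show ?case using elim(3) dist_triangle[of "integral {1..T} f / of_real T" L "integral {1..T} g / of_real T"]
        by linarith
    qed
  qed
  with f show ?thesis by (simp add: has_mean_def)
qed

text \<open>Bessel's identity. Expanding the square gives \<open>|f|^2 - X - cnj X + Y\<close>,
  where \<open>X\<close> has mean \<open>S\<close> by the coefficient hypothesis and
  \<open>Y\<close> has mean \<open>S\<close> by orthogonality, the frequencies being
  distinct.\<close>

lemma has_mean_norm_diff_trig_squared:
  assumes I: "finite I" "inj_on w I"
    and f: "continuous_on {1..} f" "has_mean (\<lambda>t. of_real (norm (f t) ^ 2)) L"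
    and coeff: "\<And>j. j \<in> I \<Longrightarrow> has_mean (\<lambda>t. f t * exp (\<i> * of_real (- w j * t))) (a j)"
  shows "has_mean (\<lambda>t. of_real (norm (f t - (\<Sum>j\<in>I. a j * exp (\<i> * of_real (w j * t)))) ^ 2))
           (L - (\<Sum>j\<in>I. of_real (norm (a j) ^ 2)))"
proof -
  define e where "e = (\<lambda>j t. exp (\<i> * of_real (w j * t)))"
  define S where "S = (\<Sum>j\<in>I. of_real (norm (a j) ^ 2) :: complex)"
  define X where "X = (\<lambda>t. \<Sum>j\<in>I. cnj (a j) * (f t * exp (\<i> * of_real (- w j * t))))"
  define Y where "Y = (\<lambda>t. \<Sum>i\<in>I. \<Sum>j\<in>I. (a i * cnj (a j)) * exp (\<i> * of_real ((w i - w j) * t)))"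
  have cnj_e: "cnj (e j t) = exp (\<i> * of_real (- w j * t))" for j t
    by (simp add: e_def exp_cnj)
  have X: "has_mean X S"
  proof -
    have "has_mean X (\<Sum>j\<in>I. cnj (a j) * a j)"
      unfolding X_def by (intro has_mean_sum has_mean_cmult coeff)
    also have "(\<Sum>j\<in>I. cnj (a j) * a j) = S"
      unfolding S_def complex_norm_square by (simp only: mult.commute)
    finally show ?thesis .
  qed
  have Y: "has_mean Y S"
  proof -
    have "has_mean Y (\<Sum>i\<in>I. \<Sum>j\<in>I. (a i * cnj (a j)) * (if w i - w j = 0 then 1 else 0))"
      unfolding Y_def by (intro has_mean_sum has_mean_cmult has_mean_exp)
    also have "(\<Sum>i\<in>I. \<Sum>j\<in>I. (a i * cnj (a j)) * (if w i - w j = 0 then 1 else 0)) =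
               (\<Sum>i\<in>I. \<Sum>j\<in>I. if i = j then of_real (norm (a i) ^ 2) else 0)"
      using I(2) by (intro sum.cong) (auto simp: complex_norm_square inj_on_def simp del: of_real_power)
    also have "\<dots> = S" unfolding S_def using I(1) by (simp add: sum.delta)
    finally show ?thesis .
  qed
  have "of_real (norm (f t - (\<Sum>j\<in>I. a j * exp (\<i> * of_real (w j * t)))) ^ 2) =
      of_real (norm (f t) ^ 2) - X t - cnj (X t) + Y t" for t
  proof -
    define P where "P = (\<Sum>j\<in>I. a j * e j t)"
    have XP: "X t = f t * cnj P"
      unfolding X_def P_def cnj_sum complex_cnj_mult cnj_e sum_distrib_left
      by (intro sum.cong) auto
    have ee: "exp (\<i> * of_real ((w i - w j) * t)) = e i t * cnj (e j t)" for i j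
      unfolding cnj_e unfolding e_def exp_add [symmetric] by (simp add: algebra_simps)
    have YP: "Y t = P * cnj P"
      unfolding Y_def P_def cnj_sum complex_cnj_mult sum_product ee
      by (intro sum.cong) auto
    have "of_real (norm (f t - P) ^ 2) = of_real (norm (f t) ^ 2) - X t - cnj (X t) + Y t"
      unfolding complex_norm_square XP YP by (simp add: algebra_simps)
    then show ?thesis by (simp add: P_def e_def)
  qed
  moreover have "has_mean (\<lambda>t. of_real (norm (f t) ^ 2) - X t - cnj (X t) + Y t) (L - S - cnj S + S)"
    by (intro has_mean_add has_mean_diff has_mean_cnj X Y f)
  moreover have "cnj S = S" by (simp add: S_def)
  ultimately show ?thesis by (simp add: S_def)
qed

section \<open>Polynomial weights and shifting the line of integration\<close>

lemma norm_one_minus_power_le: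
  fixes x :: complex
  assumes "norm x \<le> R" "R \<ge> 1"
  shows "norm (1 - x ^ n) \<le> norm (1 - x) * (real n * R ^ n)"
proof -
  have "norm (\<Sum>i<n. x ^ i) \<le> (\<Sum>i<n. R ^ n)"
  proof (rule sum_norm_le)
    fix i assume "i \<in> {..<n}"
    have "norm (x ^ i) \<le> R ^ i" using assms by (simp add: norm_power power_mono)
    also have "\<dots> \<le> R ^ n" using assms \<open>i \<in> {..<n}\<close> by (intro power_increasing) auto
    finally show "norm (x ^ i) \<le> R ^ n" .
  qed
  then show ?thesis
    unfolding one_diff_power_eq norm_mult by (intro mult_left_mono) auto
qed

lemma norm_power_diff_le:
  fixes a b :: complex
  assumes "norm a \<le> R" "norm b \<le> R" "R \<ge> 1"
  shows "norm (a ^ n - b ^ n) \<le> real n * R ^ n * norm (a - b)"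
proof (induction n)
  case (Suc n)
  have "a ^ Suc n - b ^ Suc n = a * (a ^ n - b ^ n) + (a - b) * b ^ n" by (simp add: algebra_simps)
  also have "norm \<dots> \<le> norm a * norm (a ^ n - b ^ n) + norm (a - b) * norm b ^ n"
    by (rule norm_triangle_le) (simp add: norm_mult norm_power)
  also have "\<dots> \<le> R * (real n * R ^ n * norm (a - b)) + norm (a - b) * R ^ Suc n"
  proof (intro add_mono mult_mono Suc.IH assms order.refl)
    have "norm b ^ n \<le> R ^ n" using assms by (intro power_mono) auto
    also have "\<dots> \<le> R ^ Suc n" using assms by (intro power_increasing) auto
    finally show "norm b ^ n \<le> R ^ Suc n" .
  qed (use assms in auto)
  finally show ?case by (simp add: algebra_simps)
qed auto

text \<open>For \<open>0 \<le> b \<le> 1\<close> the quotient \<open>(t + 1) / T\<close> bounds the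
  modulus of \<open>(b + it) / (iT)\<close>. The explicit primitive yields the gain
  \<open>1 / (m + 1)\<close> that makes high powers small in mean.\<close>

lemma integral_shifted_power:
  fixes T :: real
  assumes "T \<ge> 1"
  shows "(\<lambda>t. ((t + 1) / T) ^ m) integrable_on {1..T}"
    "integral {1..T} (\<lambda>t. ((t + 1) / T) ^ m) \<le> T * ((T + 1) / T) ^ Suc m / real (Suc m)"
proof -
  define G where "G = (\<lambda>t. T * ((t + 1) / T) ^ Suc m / real (Suc m))"
  have "(G has_vector_derivative ((t + 1) / T) ^ m) (at t within S)" for t S
    unfolding G_def has_real_derivative_iff_has_vector_derivative [symmetric]
    using assms by (auto intro!: derivative_eq_intros simp del: power_Suc of_nat_Suc)
  from fundamental_theorem_of_calculus[OF assms this]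
  have "((\<lambda>t. ((t + 1) / T) ^ m) has_integral G T - G 1) {1..T}" .
  moreover have "G 1 \<ge> 0" using assms by (auto simp: G_def)
  ultimately show "(\<lambda>t. ((t + 1) / T) ^ m) integrable_on {1..T}"
    "integral {1..T} (\<lambda>t. ((t + 1) / T) ^ m) \<le> T * ((T + 1) / T) ^ Suc m / real (Suc m)"
    by (auto simp: integral_unique G_def integrable_on_def)
qed

text \<open>The mean square of the complementary weight is of order \<open>1 / N\<close>. The argument
  \<open>u = (b + it) / (iT)\<close> of the weight \<open>(1 - u\<^sup>N)\<^sup>k\<close> lies off the real line for \<open>b \<noteq> 0\<close>, which is needed on a
  shifted vertical line.\<close>

lemma weight_error_small:
  fixes H :: "real \<Rightarrow> complex"
  assumes cont: "continuous_on {1..} H" and C: "C > 0"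
    and bd: "\<forall>\<^sub>F T in at_top. integral {1..T} (\<lambda>t. norm (H t) ^ 2) \<le> C * T"
    and b: "0 \<le> b" "b \<le> 1" and \<epsilon>: "\<epsilon> > 0"
  shows "\<forall>\<^sub>F N in sequentially. \<forall>\<^sub>F T in at_top.
    norm (integral {1..T} (\<lambda>t. H t * (1 - (1 - (Complex b t / (\<i> * of_real T)) ^ N) ^ k))) \<le> \<epsilon> * T"
proof -
  \<comment> \<open>Below \<open>|1 - u^N| \<le> 3\<close>, so \<open>K\<close> is the constant in
    \<open>|1 - (1 - u^N)^k| \<le> K |u^N|\<close>.\<close>
  define K where "K = real k * 3 ^ k"
  \<comment> \<open>Chosen so that the part \<open>\<eta> / 2 * (C * T)\<close> of the final bound
    is exactly \<open>\<epsilon> / 2 * T\<close>.\<close>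
  define \<eta> where "\<eta> = \<epsilon> / C"
  have \<eta>: "\<eta> > 0" using C \<epsilon> by (simp add: \<eta>_def)
  have "((\<lambda>N. K\<^sup>2 / (\<eta> * real (Suc (2 * N)))) \<longlongrightarrow> 0) sequentially"
    using \<eta> by real_asymp
  then have "\<forall>\<^sub>F N in sequentially. K\<^sup>2 / (\<eta> * real (Suc (2 * N))) < \<epsilon> / 2"
    using \<epsilon> by (intro order_tendstoD) auto
  then show ?thesis
  proof eventually_elim
    case (elim N)
    have "((\<lambda>T::real. ((T + 1) / T) ^ m) \<longlongrightarrow> 1) at_top" for m
    proof -
      have "((\<lambda>T::real. (T + 1) / T) \<longlongrightarrow> 1) at_top" by real_asymp
      from tendsto_power[OF this, of m] show ?thesis by simp
    qed
    then have ev: "\<forall>\<^sub>F T::real in at_top. ((T + 1) / T) ^ m < 2" for m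
      by (intro order_tendstoD) auto
    \<comment> \<open>\<open>N\<close> is fixed before \<open>T\<close>, so for large
      \<open>T\<close> these powers of \<open>(T + 1) / T\<close> are below 2.\<close>
    from bd ev[of N] ev[of "Suc (2 * N)"] eventually_ge_at_top[of 1] show ?case
    proof eventually_elim
      case T: (elim T)
      define W where "W = (\<lambda>t. (1 - (Complex b t / (\<i> * of_real T)) ^ N) ^ k)"
      define q where "q = (\<lambda>t. (t + 1) / T)"
      have "continuous_on {1..} (\<lambda>t. Complex b t / (\<i> * of_real T))"
        using T(4) by (intro continuous_intros) (auto simp: Complex_eq intro!: continuous_intros)
      then have cW: "continuous_on {1..} (\<lambda>t. H t * (1 - W t))"
        unfolding W_def
        by (intro continuous_on_mult continuous_on_diff continuous_on_power continuous_on_const cont)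
      have cH: "continuous_on {1..} (\<lambda>t. norm (H t) ^ 2)" by (intro continuous_intros cont)
      have int1: "(\<lambda>t. \<eta> / 2 * norm (H t) ^ 2) integrable_on {1..T}"
        by (intro integrable_on_mult_right integrable_on_half_line cH)
      have int2: "(\<lambda>t. K\<^sup>2 / (2 * \<eta>) * q t ^ (2 * N)) integrable_on {1..T}"
        unfolding q_def by (intro integrable_on_mult_right integral_shifted_power T(4))
      have "norm (integral {1..T} (\<lambda>t. H t * (1 - W t))) \<le>
          integral {1..T} (\<lambda>t. \<eta> / 2 * norm (H t) ^ 2 + K\<^sup>2 / (2 * \<eta>) * q t ^ (2 * N))"
      proof (rule integral_norm_bound_integral)
        show "(\<lambda>t. H t * (1 - W t)) integrable_on {1..T}" by (rule integrable_on_half_line[OF cW])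
        show "(\<lambda>t. \<eta> / 2 * norm (H t) ^ 2 + K\<^sup>2 / (2 * \<eta>) * q t ^ (2 * N)) integrable_on {1..T}"
          by (intro integrable_add int1 int2)
        fix t assume t: "t \<in> {1..T}"
        define u where "u = Complex b t / (\<i> * of_real T)"
        have "norm (Complex b t) \<le> 1 + t"
          using t b cmod_le[of "Complex b t"] by simp
        then have "norm u \<le> q t"
          using T(4) by (simp add: u_def q_def norm_divide norm_mult divide_right_mono add.commute)
        then have uN: "norm (u ^ N) \<le> q t ^ N"
          unfolding norm_power by (intro power_mono) auto
        also have "q t ^ N \<le> ((T + 1) / T) ^ N"
          unfolding q_def using t T(4) by (intro power_mono divide_right_mono) auto
        finally have "norm (u ^ N) \<le> 2" using T(2) by linarith
        then have "norm (1 - u ^ N) \<le> 3" using norm_triangle_ineq4[of 1 "u ^ N"] by simp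
        from norm_one_minus_power_le[OF this, of k]
        have "norm (1 - W t) \<le> norm (u ^ N) * K" by (simp add: W_def u_def K_def)
        also have "\<dots> \<le> q t ^ N * K" using uN by (intro mult_right_mono) (auto simp: K_def)
        finally have w: "norm (1 - W t) \<le> K * q t ^ N" by (simp add: mult.commute)
        \<comment> \<open>A weighted arithmetic-geometric inequality separates \<open>H\<close> from
          the weight, so that only the mean squares of the two are needed.\<close>
        have amgm: "x * y \<le> \<eta> / 2 * x\<^sup>2 + y\<^sup>2 / (2 * \<eta>)" for x y
        proof -
          have "0 \<le> (\<eta> * x - y)\<^sup>2 / (2 * \<eta>)" using \<eta> by auto
          also have "\<dots> = \<eta> / 2 * x\<^sup>2 + y\<^sup>2 / (2 * \<eta>) - x * y"
            using \<eta> by (simp add: power2_eq_square field_simps)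
          finally show ?thesis by simp
        qed
        have "norm (H t * (1 - W t)) \<le> norm (H t) * (K * q t ^ N)"
          unfolding norm_mult using w by (intro mult_left_mono) auto
        also have "\<dots> \<le> \<eta> / 2 * norm (H t) ^ 2 + (K * q t ^ N)\<^sup>2 / (2 * \<eta>)" by (rule amgm)
        finally show "norm (H t * (1 - W t)) \<le> \<eta> / 2 * norm (H t) ^ 2 + K\<^sup>2 / (2 * \<eta>) * q t ^ (2 * N)"
          by (simp add: power_mult_distrib power_mult [symmetric] mult.commute)
      qed
      also have "\<dots> = \<eta> / 2 * integral {1..T} (\<lambda>t. norm (H t) ^ 2) +
            K\<^sup>2 / (2 * \<eta>) * integral {1..T} (\<lambda>t. q t ^ (2 * N))"
        by (subst integral_add[OF int1 int2]) simp
      also have "\<dots> \<le> \<eta> / 2 * (C * T) + K\<^sup>2 / (2 * \<eta>) * (T * 2 / real (Suc (2 * N)))"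
      proof (intro add_mono mult_left_mono)
        have "integral {1..T} (\<lambda>t. q t ^ (2 * N)) \<le> T * ((T + 1) / T) ^ Suc (2 * N) / real (Suc (2 * N))"
          unfolding q_def by (rule integral_shifted_power(2)[OF T(4)])
        also have "\<dots> \<le> T * 2 / real (Suc (2 * N))"
          using T(3,4) by (intro divide_right_mono mult_left_mono) auto
        finally show "integral {1..T} (\<lambda>t. q t ^ (2 * N)) \<le> T * 2 / real (Suc (2 * N))" .
      qed (use T(1) \<eta> in auto)
      also have "\<dots> = \<epsilon> / 2 * T + K\<^sup>2 / (\<eta> * real (Suc (2 * N))) * T"
        using \<eta> C by (simp add: \<eta>_def)
      also have "\<dots> \<le> \<epsilon> / 2 * T + \<epsilon> / 2 * T"
        using elim T(4) by (intro add_mono mult_right_mono) auto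
      also have "\<dots> = \<epsilon> * T" by simp
      finally show ?case by (simp add: W_def)
    qed
  qed
qed

text \<open>Cauchy's theorem on a rectangle by means of a primitive, which exists because the open
  quadrant is convex; the quadrant also avoids the pole of zeta at 1. Vertical integrals are
  increments of the primitive, so their difference equals that of the increments along the two
  horizontal edges of length \<open>c - \<sigma>\<close>.\<close>

lemma vertical_line_shift:
  assumes F: "F holomorphic_on {s. Re s > 0 \<and> Im s > 0}" and \<sigma>: "0 < \<sigma>" "\<sigma> \<le> c" and T: "T \<ge> 1"
    and B1: "\<And>x. x \<in> {\<sigma>..c} \<Longrightarrow> norm (F (Complex x 1)) \<le> B1"
    and B2: "\<And>x. x \<in> {\<sigma>..c} \<Longrightarrow> norm (F (Complex x T)) \<le> B2"
  shows "norm (integral {1..T} (\<lambda>t. F (Complex \<sigma> t)) - integral {1..T} (\<lambda>t. F (Complex c t)))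
           \<le> (B1 + B2) * (c - \<sigma>)"
proof -
  define U where "U = {s. Re s > 0 \<and> Im s > 0}"
  have U: "U = {s. Re s > 0} \<inter> {s. Im s > 0}" by (auto simp: U_def)
  have "convex U" "open U" unfolding U
    by (intro convex_Int open_Int convex_halfspace_Re_gt convex_halfspace_Im_gt
        open_halfspace_Re_gt open_halfspace_Im_gt)+
  with F obtain g where g: "\<And>s. s \<in> U \<Longrightarrow> (g has_field_derivative F s) (at s within U)"
    using holomorphic_convex_primitive'[of U F] unfolding U_def by blast
  have g': "(g has_field_derivative F s) (at s within S)" if "s \<in> U" for s S
    using g[OF that] that \<open>open U\<close> by (metis at_within_open has_field_derivative_at_within)
  have int: "integral {1..T} (\<lambda>t. F (Complex x t)) = (g (Complex x T) - g (Complex x 1)) / \<i>"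
    if x: "x > 0" for x
  proof -
    have "((\<lambda>t. g (Complex x t) / \<i>) has_vector_derivative F (Complex x t)) (at t within {1..T})"
      if "t \<in> {1..T}" for t
    proof -
      have "Complex x t \<in> U" using x that by (auto simp: U_def)
      have "(Complex x has_vector_derivative \<i>) (at t within {1..T})"
        unfolding Complex_eq by (auto intro!: derivative_eq_intros)
      from field_vector_diff_chain_within[OF this g'[OF \<open>Complex x t \<in> U\<close>]]
      have "(g \<circ> Complex x has_vector_derivative \<i> * F (Complex x t)) (at t within {1..T})" .
      from has_vector_derivative_divide[OF this, of \<i>] show ?thesis by (simp add: o_def)
    qed
    from fundamental_theorem_of_calculus[OF T this] show ?thesis
      by (simp add: integral_unique algebra_simps)
  qed
  have hor: "norm (g (Complex c t) - g (Complex \<sigma> t)) \<le> B * (c - \<sigma>)"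
    if t: "t > 0" and B: "\<And>x. x \<in> {\<sigma>..c} \<Longrightarrow> norm (F (Complex x t)) \<le> B" for t B
  proof -
    define S where "S = closed_segment (Complex \<sigma> t) (Complex c t)"
    have S: "\<exists>x\<in>{\<sigma>..c}. s = Complex x t" if "s \<in> S" for s
    proof (rule bexI[of _ "Re s"])
      show "s = Complex (Re s) t" "Re s \<in> {\<sigma>..c}"
        using that \<sigma>(2) unfolding S_def
        by (auto simp: complex_eq_iff closed_segment_same_Im closed_segment_eq_real_ivl)
    qed
    have "norm (g (Complex c t) - g (Complex \<sigma> t)) \<le> B * norm (Complex c t - Complex \<sigma> t)"
    proof (rule field_differentiable_bound[where S = S and f' = F])
      fix s assume "s \<in> S"
      then obtain x where x: "x \<in> {\<sigma>..c}" "s = Complex x t" using S by blast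
      then have "s \<in> U" using t \<sigma>(1) by (auto simp: U_def)
      then show "(g has_field_derivative F s) (at s within S)" by (rule g')
      show "norm (F s) \<le> B" using x B by auto
    qed (auto simp: S_def)
    also have "Complex c t - Complex \<sigma> t = of_real (c - \<sigma>)" by (simp add: complex_eq_iff)
    finally show ?thesis using \<sigma> by (simp del: of_real_diff)
  qed
  have "integral {1..T} (\<lambda>t. F (Complex \<sigma> t)) - integral {1..T} (\<lambda>t. F (Complex c t)) =
      ((g (Complex c 1) - g (Complex \<sigma> 1)) - (g (Complex c T) - g (Complex \<sigma> T))) / \<i>"
    using \<sigma> by (simp add: int algebra_simps)
  also have "norm \<dots> \<le> norm (g (Complex c 1) - g (Complex \<sigma> 1)) + norm (g (Complex c T) - g (Complex \<sigma> T))"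
    unfolding norm_divide norm_ii div_by_1 by (rule norm_triangle_ineq4)
  also have "\<dots> \<le> B1 * (c - \<sigma>) + B2 * (c - \<sigma>)"
    using T by (intro add_mono hor B1 B2) auto
  finally show ?thesis by (simp add: algebra_simps)
qed

subsection \<open>Mean values of powers of zeta\<close>

lemma has_mean_uniform_approx:
  assumes f: "continuous_on {1..} f"
    and appr: "\<And>\<epsilon>. \<epsilon> > 0 \<Longrightarrow> \<exists>g. has_mean g L \<and> (\<forall>t\<ge>1. norm (f t - g t) \<le> \<epsilon>)"
  shows "has_mean f L"
proof (rule has_mean_approx[OF f])
  fix \<epsilon> :: real assume \<epsilon>: "\<epsilon> > 0"
  then obtain g where g: "has_mean g L" "\<And>t. t \<ge> 1 \<Longrightarrow> norm (f t - g t) \<le> \<epsilon>"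
    using appr by blast
  have "norm (integral {1..T} f - integral {1..T} g) \<le> \<epsilon> * T" if "T \<ge> 1" for T
  proof -
    have "integral {1..T} f - integral {1..T} g = integral {1..T} (\<lambda>t. f t - g t)"
      by (intro integral_diff [symmetric] integrable_on_half_line f has_meanD[OF g(1)])
    also have "norm \<dots> \<le> integral {1..T} (\<lambda>t. \<epsilon>)"
      by (intro integral_norm_bound_integral integrable_diff integrable_on_half_line f has_meanD[OF g(1)])
         (auto intro: g)
    also have "\<dots> \<le> \<epsilon> * T" using that \<epsilon> by (simp add: algebra_simps)
    finally show ?thesis .
  qed
  then have "\<forall>\<^sub>F T in at_top. norm (integral {1..T} f - integral {1..T} g) \<le> \<epsilon> * T"
    by (rule eventually_mono[OF eventually_ge_at_top[of 1]])
  with g(1) show "\<exists>g. has_mean g L \<and> (\<forall>\<^sub>F T in at_top. norm (integral {1..T} f - integral {1..T} g) \<le> \<epsilon> * T)"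
    by blast
qed

section \<open>Powers of Dirichlet polynomials\<close>

lemma sum_power_lists:
  fixes g :: "'a \<Rightarrow> 'b :: comm_semiring_1"
  assumes "finite A"
  shows "(\<Sum>x\<in>A. g x) ^ k = (\<Sum>xs | set xs \<subseteq> A \<and> length xs = k. prod_list (map g xs))"
proof (induction k)
  case 0
  have "{xs. set xs \<subseteq> A \<and> length xs = 0} = {[]}" by auto
  then show ?case by simp
next
  case (Suc k)
  let ?L = "\<lambda>k. {xs. set xs \<subseteq> A \<and> length xs = k}"
  have "(\<Sum>xs\<in>?L (Suc k). prod_list (map g xs)) = (\<Sum>(xs, x)\<in>?L k \<times> A. prod_list (map g xs) * g x)"
    unfolding lists_length_Suc_eq
    by (subst sum.reindex) (auto simp: inj_on_def case_prod_unfold mult.commute)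
  also have "\<dots> = (\<Sum>xs\<in>?L k. prod_list (map g xs)) * (\<Sum>x\<in>A. g x)"
    by (simp add: sum_product sum.cartesian_product)
  finally show ?case by (simp add: Suc.IH mult.commute)
qed

lemma dirichlet_term_exp:
  fixes s :: complex
  assumes "x \<ge> 1"
  shows "1 / of_nat x powr s = exp (- s * of_real (ln (real x)))"
proof -
  have "Ln (of_nat x) = of_real (ln (real x))"
    using Ln_of_real[of "real x"] assms by simp
  then show ?thesis using assms by (simp add: powr_def exp_minus field_simps)
qed

text \<open>Positivity of the product is carried through the induction because splitting the
  logarithm of a product relies on it.\<close>

lemma prod_list_dirichlet_terms:
  fixes s :: complex
  assumes "\<And>x. x \<in> set xs \<Longrightarrow> x \<ge> 1"
  shows "(\<Prod>x\<leftarrow>xs. 1 / of_nat x powr s) = exp (- s * of_real (ln (real (prod_list xs)))) \<and> prod_list xs \<ge> 1"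
  using assms
proof (induction xs)
  case (Cons x xs)
  then have x: "x \<ge> 1" and IH: "(\<Prod>x\<leftarrow>xs. 1 / of_nat x powr s) = exp (- s * of_real (ln (real (prod_list xs))))"
      "prod_list xs \<ge> 1"
    by auto
  have "x * prod_list xs \<ge> 1" using mult_le_mono[OF x IH(2)] by simp
  moreover have "ln (real (x * prod_list xs)) = ln (real x) + ln (real (prod_list xs))"
    using x IH(2) by (simp add: ln_mult)
  moreover have "exp (- s * of_real (ln (real x))) * exp (- s * of_real (ln (real (prod_list xs)))) =
      exp (- s * of_real (ln (real x) + ln (real (prod_list xs))))"
    unfolding exp_add [symmetric] by (simp add: algebra_simps)
  ultimately show ?case unfolding list.map prod_list.Cons IH(1) dirichlet_term_exp[OF x] by simp
qed auto

text \<open>Every factor divides \<open>n\<close>, hence is at most \<open>m\<close>: a Dirichlet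
  polynomial of length \<open>m \<ge> n\<close> already has the exact coefficient at
  \<open>n\<close> in its \<open>k\<close>-th power.\<close>

lemma divisor_fun_eq_card_bounded:
  assumes "1 \<le> n" "n \<le> m"
  shows "divisor_fun k n = card {xs. set xs \<subseteq> {1..m} \<and> length xs = k \<and> prod_list xs = n}"
proof -
  have "set xs \<subseteq> {1..m}" if "prod_list xs = n" for xs
  proof
    fix x assume "x \<in> set xs"
    then have "x dvd n" using that by (auto intro: prod_list_dvd)
    with assms show "x \<in> {1..m}" using dvd_imp_le[of x n] by (cases "x = 0") auto
  qed
  then have "{xs. set xs \<subseteq> {1..m} \<and> length xs = k \<and> prod_list xs = n} = {xs. length xs = k \<and> prod_list xs = n}"
    by blast
  then show ?thesis by (simp add: divisor_fun_def)
qed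

section \<open>Fourier-Bohr coefficients of powers of zeta\<close>

lemma continuous_on_zeta_line:
  "continuous_on {1..} (\<lambda>t. zeta (Complex x t))"
proof -
  have "continuous_on {1..} (zeta \<circ> Complex x)"
  proof (rule continuous_on_compose)
    show "continuous_on {1..} (Complex x)" unfolding Complex_eq by (intro continuous_intros)
    show "continuous_on (Complex x ` {1..}) zeta"
      by (rule continuous_on_subset[OF holomorphic_on_imp_continuous_on[OF holomorphic_zeta]])
         (auto simp: complex_eq_iff)
  qed
  then show ?thesis by (simp add: o_def)
qed

lemma norm_zeta_le:
  assumes "Re s > 1"
  shows "norm (zeta s) \<le> (\<Sum>j. real (Suc j) powr - Re s)"
  unfolding sums_unique[OF zeta_sums[OF assms]]
  by (intro norm_suminf_le summable_Suc_powr assms) (simp only: norm_dirichlet_term order.refl)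

text \<open>The partial sums converge uniformly on the line, and so do their \<open>k\<close>-th
  powers. These powers are trigonometric polynomials whose coefficient at \<open>n\<close> is exact
  once the length reaches \<open>n\<close>, so all approximations share the required mean.\<close>

lemma has_mean_zeta_power_right:
  assumes c: "c > 1" and n: "n \<ge> 1"
  shows "has_mean (\<lambda>t. zeta (Complex c t) ^ k * exp (\<i> * of_real (ln (real n) * t)))
           (of_real (real (divisor_fun k n) * real n powr - c))"
proof (rule has_mean_uniform_approx)
  show "continuous_on {1..} (\<lambda>t. zeta (Complex c t) ^ k * exp (\<i> * of_real (ln (real n) * t)))"
    by (intro continuous_intros continuous_on_zeta_line)
  fix \<epsilon> :: real assume \<epsilon>: "\<epsilon> > 0"
  define D where "D = (\<lambda>m t. \<Sum>j<m. 1 / of_nat (Suc j) powr Complex c t)"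
  define Z where "Z = (\<Sum>j. real (Suc j) powr - c)"
  have sm: "summable (\<lambda>j. real (Suc j) powr - c)" by (rule summable_Suc_powr[OF c])
  have term_le: "norm (1 / of_nat (Suc j) powr Complex c t) \<le> real (Suc j) powr - c" for j t
    by (simp only: norm_dirichlet_term complex.sel order.refl)
  have sums: "(\<lambda>j. 1 / of_nat (Suc j) powr Complex c t) sums zeta (Complex c t)" for t
    by (rule zeta_sums) (simp add: c)
  have zeta_eq: "zeta (Complex c t) = (\<Sum>j. 1 / of_nat (Suc j) powr Complex c t)" for t
    by (rule sums_unique[OF sums])
  have Z0: "Z \<ge> 0" unfolding Z_def by (intro suminf_nonneg sm) auto
  have zeta_le: "norm (zeta (Complex c t)) \<le> 1 + Z" for t
    using norm_zeta_le[of "Complex c t"] c by (simp add: Z_def)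
  have D_le: "norm (D m t) \<le> 1 + Z" for m t
  proof -
    have "norm (D m t) \<le> (\<Sum>j<m. real (Suc j) powr - c)"
      unfolding D_def by (intro sum_norm_le term_le)
    also have "\<dots> \<le> Z" unfolding Z_def by (intro sum_le_suminf sm) auto
    finally show ?thesis by simp
  qed
  \<comment> \<open>The \<open>k\<close>-th power map has Lipschitz constant at most
    \<open>k (1 + Z)^k\<close> on the disc of radius \<open>1 + Z\<close>; the added 1 keeps the
    denominator positive for \<open>k = 0\<close>.\<close>
  define \<delta> where "\<delta> = \<epsilon> / (real k * (1 + Z) ^ k + 1)"
  have pos: "real k * (1 + Z) ^ k + 1 > 0" using Z0 by (intro add_nonneg_pos) auto
  then have \<delta>: "\<delta> > 0" using \<epsilon> by (simp add: \<delta>_def)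
  have "uniform_limit UNIV D (\<lambda>t. zeta (Complex c t)) sequentially"
    unfolding D_def zeta_eq by (rule Weierstrass_m_test[OF term_le sm])
  from uniform_limitD[OF this \<delta>] eventually_ge_at_top[of n]
  have "\<forall>\<^sub>F m in sequentially. (\<forall>t. dist (D m t) (zeta (Complex c t)) < \<delta>) \<and> m \<ge> n"
    by eventually_elim auto
  then obtain m where m: "\<And>t. dist (D m t) (zeta (Complex c t)) < \<delta>" "m \<ge> n"
    by (auto dest!: eventually_happens)
  define L where "L = {xs. set xs \<subseteq> {1..m} \<and> length xs = k}"
  have finL: "finite L" unfolding L_def by (intro finite_lists_length_eq) auto
  define P where "P = (\<lambda>xs. real (prod_list xs))"
  have P: "P xs > 0" if "xs \<in> L" for xs
  proof -
    have "prod_list xs \<ge> 1"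
      using prod_list_dirichlet_terms[of xs undefined] that by (auto simp: L_def subset_iff)
    then show ?thesis by (simp add: P_def)
  qed
  define g where "g = (\<lambda>t. \<Sum>xs\<in>L. of_real (P xs powr - c) * exp (\<i> * of_real ((ln (real n) - ln (P xs)) * t)))"
  have g: "D m t ^ k * exp (\<i> * of_real (ln (real n) * t)) = g t" for t
  proof -
    have "D m t = (\<Sum>j\<in>{1..m}. 1 / of_nat j powr Complex c t)"
      unfolding D_def by (rule sum.reindex_bij_witness[of _ "\<lambda>j. j - 1" Suc]) auto
    \<comment> \<open>A list records the summand chosen from each of the \<open>k\<close> factors,
      the same encoding of factorisations as in \<open>divisor_fun\<close>.\<close>
    then have "D m t ^ k = (\<Sum>xs\<in>L. (\<Prod>x\<leftarrow>xs. 1 / of_nat x powr Complex c t))"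
      unfolding L_def by (simp only: sum_power_lists finite_atLeastAtMost)
    also have "\<dots> = (\<Sum>xs\<in>L. of_real (P xs powr - c) * exp (- \<i> * of_real (ln (P xs) * t)))"
    proof (intro sum.cong refl)
      fix xs assume xs: "xs \<in> L"
      have "(\<Prod>x\<leftarrow>xs. 1 / of_nat x powr Complex c t) = exp (- Complex c t * of_real (ln (P xs)))"
        unfolding P_def using xs by (intro conjunct1[OF prod_list_dirichlet_terms]) (auto simp: L_def)
      also have "- Complex c t * of_real (ln (P xs)) = of_real (- c * ln (P xs)) + - \<i> * of_real (ln (P xs) * t)"
        by (simp add: complex_eq_iff)
      also have "exp \<dots> = of_real (P xs powr - c) * exp (- \<i> * of_real (ln (P xs) * t))"
        unfolding exp_add exp_of_real using P[OF xs] by (simp add: powr_def)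
      finally show "(\<Prod>x\<leftarrow>xs. 1 / of_nat x powr Complex c t) =
          of_real (P xs powr - c) * exp (- \<i> * of_real (ln (P xs) * t))" .
    qed
    also have "\<dots> * exp (\<i> * of_real (ln (real n) * t)) = g t"
      unfolding g_def sum_distrib_right mult.assoc exp_add [symmetric]
      by (intro sum.cong refl arg_cong2[where f = "(*)"] arg_cong[where f = exp]) (simp add: algebra_simps)
    finally show ?thesis .
  qed
  have "has_mean g (\<Sum>xs\<in>L. of_real (P xs powr - c) * (if ln (real n) - ln (P xs) = 0 then 1 else 0))"
    unfolding g_def by (intro has_mean_sum has_mean_cmult has_mean_exp)
  also have "(\<Sum>xs\<in>L. of_real (P xs powr - c) * (if ln (real n) - ln (P xs) = 0 then 1 else 0)) =
      (\<Sum>xs\<in>L. if prod_list xs = n then of_real (real n powr - c) else (0 :: complex))"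
  proof (intro sum.cong refl)
    fix xs assume "xs \<in> L"
    then have "ln (real n) - ln (P xs) = 0 \<longleftrightarrow> prod_list xs = n"
      using P[of xs] n by (auto simp: P_def)
    then show "of_real (P xs powr - c) * (if ln (real n) - ln (P xs) = 0 then 1 else 0) =
      (if prod_list xs = n then of_real (real n powr - c) else (0 :: complex))"
      by (simp add: P_def)
  qed
  also have "\<dots> = of_real (real (card {xs \<in> L. prod_list xs = n}) * real n powr - c)"
    using finL by (simp add: sum.If_cases Int_def)
  also have "{xs \<in> L. prod_list xs = n} = {xs. set xs \<subseteq> {1..m} \<and> length xs = k \<and> prod_list xs = n}"
    by (auto simp: L_def)
  also have "card \<dots> = divisor_fun k n"
    by (rule divisor_fun_eq_card_bounded[OF n m(2), symmetric])
  finally have "has_mean g (of_real (real (divisor_fun k n) * real n powr - c))" .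
  moreover have "norm (zeta (Complex c t) ^ k * exp (\<i> * of_real (ln (real n) * t)) - g t) \<le> \<epsilon>" for t
  proof -
    have "zeta (Complex c t) ^ k * exp (\<i> * of_real (ln (real n) * t)) - g t =
        (zeta (Complex c t) ^ k - D m t ^ k) * exp (\<i> * of_real (ln (real n) * t))"
      by (simp add: g [symmetric] algebra_simps)
    also have "norm \<dots> = norm (zeta (Complex c t) ^ k - D m t ^ k)" by (simp add: norm_mult)
    also have "\<dots> \<le> real k * (1 + Z) ^ k * norm (zeta (Complex c t) - D m t)"
      by (intro norm_power_diff_le zeta_le D_le) (use Z0 in auto)
    also have "\<dots> \<le> (real k * (1 + Z) ^ k + 1) * \<delta>"
      using m(1)[of t] Z0 by (intro mult_mono) (auto simp: dist_norm norm_minus_commute)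
    also have "\<dots> = \<epsilon>" using pos by (simp add: \<delta>_def)
    finally show ?thesis .
  qed
  ultimately show "\<exists>g. has_mean g (of_real (real (divisor_fun k n) * real n powr - c)) \<and>
     (\<forall>t\<ge>1. norm (zeta (Complex c t) ^ k * exp (\<i> * of_real (ln (real n) * t)) - g t) \<le> \<epsilon>)"
    by blast
qed

text \<open>The mean square hypothesis pays for the weight on the line \<open>\<sigma>\<close>, and
  boundedness of zeta pays for it on the line \<open>\<sigma> + 1\<close>. On the top edge the
  growth \<open>T^k\<close> of the \<open>k\<close>-th power of zeta meets the decay
  \<open>T^-k\<close> of the weight, so the horizontal edges contribute a constant, which is
  negligible against \<open>T\<close>.\<close>

lemma has_mean_zeta_power:
  assumes \<sigma>: "\<sigma> > 0" and n: "n \<ge> 1"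
    and bd: "\<forall>\<^sub>F T in at_top. integral {1..T} (\<lambda>t. norm (zeta (Complex \<sigma> t) ^ k) ^ 2) \<le> C * T"
  shows "has_mean (\<lambda>t. zeta (Complex \<sigma> t) ^ k * exp (\<i> * of_real (ln (real n) * t)))
           (of_real (real (divisor_fun k n) * real n powr - \<sigma>))"
proof -
  \<comment> \<open>This exceeds 1, and the unit width puts the offsets 0 and 1 of the two lines in
    the range of the weight estimate.\<close>
  define c where "c = \<sigma> + 1"
  \<comment> \<open>Subtracting \<open>\<sigma>\<close> makes the exponential factor unimodular on
    the line \<open>\<sigma>\<close>; on the line \<open>c\<close> it contributes the extra factor
    \<open>n\<close>, which compensates \<open>n^-c\<close> against
    \<open>n^-\<sigma>\<close>.\<close>
  define G where "G = (\<lambda>s. zeta s ^ k * exp ((s - of_real \<sigma>) * of_real (ln (real n))))"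
  have norm_G: "norm (G s) \<le> norm (zeta s) ^ k * n" if "Re s \<le> c" for s
  proof -
    have "norm (exp ((s - of_real \<sigma>) * of_real (ln (real n)))) = exp ((Re s - \<sigma>) * ln (real n))"
      by simp
    also have "\<dots> \<le> exp (1 * ln (real n))"
      unfolding exp_le_cancel_iff using that n by (intro mult_right_mono) (auto simp: c_def)
    also have "\<dots> = real n" using n by simp
    finally show ?thesis
      unfolding G_def norm_mult norm_power by (intro mult_left_mono) auto
  qed
  have G_line: "G (Complex (\<sigma> + b) t) =
      of_real (real n powr b) * (zeta (Complex (\<sigma> + b) t) ^ k * exp (\<i> * of_real (ln (real n) * t)))" for b t
  proof -
    have "(Complex (\<sigma> + b) t - of_real \<sigma>) * of_real (ln (real n)) =
        of_real (b * ln (real n)) + \<i> * of_real (ln (real n) * t)"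
      by (simp add: complex_eq_iff)
    then show ?thesis
      unfolding G_def using n by (simp add: exp_add powr_def exp_of_real [symmetric])
  qed
  have G_cont: "continuous_on {1..} (\<lambda>t. G (Complex x t))" for x
    using G_line[of "x - \<sigma>"] by (auto intro!: continuous_intros continuous_on_zeta_line)
  obtain K where K: "K > 0" "\<And>s. Re s \<ge> \<sigma> \<Longrightarrow> Im s \<ge> 1 \<Longrightarrow> norm (zeta s) \<le> K * norm s"
    using zeta_linear_growth[OF \<sigma>] by blast
  have G_growth: "norm (G (Complex x t)) \<le> (K * (\<sigma> + 2) * t) ^ k * n" if "x \<in> {\<sigma>..c}" "t \<ge> 1" for x t
  proof -
    have "norm (Complex x t) \<le> x + t" using cmod_le[of "Complex x t"] that \<sigma> by simp
    also have "\<dots> \<le> (\<sigma> + 1) * t + t"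
    proof -
      have "(\<sigma> + 1) * 1 \<le> (\<sigma> + 1) * t" using that \<sigma> by (intro mult_left_mono) auto
      then show ?thesis using that by (simp add: c_def)
    qed
    finally have "K * norm (Complex x t) \<le> K * ((\<sigma> + 2) * t)"
      using K(1) by (intro mult_left_mono) (auto simp: algebra_simps)
    with K(2)[of "Complex x t"] that have "norm (zeta (Complex x t)) \<le> K * (\<sigma> + 2) * t"
      by (simp add: mult.assoc)
    then have "norm (zeta (Complex x t)) ^ k * n \<le> (K * (\<sigma> + 2) * t) ^ k * n"
      by (intro mult_right_mono power_mono) auto
    with norm_G[of "Complex x t"] that show ?thesis by simp
  qed
  have "has_mean (\<lambda>t. G (Complex \<sigma> t)) (of_real (real (divisor_fun k n) * real n powr - \<sigma>))"
  proof (rule has_mean_approx[OF G_cont])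
    fix \<epsilon> :: real assume \<epsilon>: "\<epsilon> > 0"
    have "c > 1" using \<sigma> by (simp add: c_def)
    from has_mean_cmult[OF has_mean_zeta_power_right[OF this n, of k], of "of_real (real n)"]
    have "has_mean (\<lambda>t. G (Complex c t)) (of_real (real n) * of_real (real (divisor_fun k n) * real n powr - c))"
      using n by (simp add: c_def G_line)
    also have "of_real (real n) * of_real (real (divisor_fun k n) * real n powr - c) =
        (of_real (real (divisor_fun k n) * real n powr - \<sigma>) :: complex)"
    proof -
      have "real n powr - \<sigma> = real n powr 1 * real n powr - c"
        unfolding powr_add [symmetric] by (simp add: c_def)
      then show ?thesis using n by simp
    qed
    finally have mean_c: "has_mean (\<lambda>t. G (Complex c t)) (of_real (real (divisor_fun k n) * real n powr - \<sigma>))" .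

    \<comment> \<open>\<open>max C 1\<close> supplies the positive constant asked for by the weight
      estimate, as \<open>C\<close> is arbitrary.\<close>
    have bd_\<sigma>: "\<forall>\<^sub>F T in at_top. integral {1..T} (\<lambda>t. norm (G (Complex \<sigma> t)) ^ 2) \<le> max C 1 * T"
      using bd eventually_ge_at_top[of 0]
    proof eventually_elim
      case (elim T)
      have "norm (G (Complex \<sigma> t)) = norm (zeta (Complex \<sigma> t) ^ k)" for t
        using G_line[of 0 t] n by (simp add: norm_mult)
      moreover have "C * T \<le> max C 1 * T" using elim by (intro mult_right_mono) auto
      ultimately show ?case using elim by simp
    qed
    obtain Z where Z: "\<And>t. t \<ge> 1 \<Longrightarrow> norm (G (Complex c t)) \<le> Z" 
    proof
      fix t :: real
      have "norm (zeta (Complex c t)) \<le> (\<Sum>j. real (Suc j) powr - c)"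
        using norm_zeta_le[of "Complex c t"] \<open>c > 1\<close> by simp
      then have "norm (zeta (Complex c t)) ^ k * n \<le> (\<Sum>j. real (Suc j) powr - c) ^ k * n"
        by (intro mult_right_mono power_mono) auto
      with norm_G[of "Complex c t"] show "norm (G (Complex c t)) \<le> (\<Sum>j. real (Suc j) powr - c) ^ k * n"
        by simp
    qed
    have bd_c: "\<forall>\<^sub>F T in at_top. integral {1..T} (\<lambda>t. norm (G (Complex c t)) ^ 2) \<le> (Z\<^sup>2 + 1) * T"
      using eventually_ge_at_top[of 1]
    proof eventually_elim
      case (elim T)
      have "integral {1..T} (\<lambda>t. norm (G (Complex c t)) ^ 2) \<le> integral {1..T} (\<lambda>t. Z\<^sup>2)"
        using Z by (intro integral_le integrable_on_half_line continuous_intros G_cont) (auto intro!: power_mono)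
      also have "\<dots> \<le> (Z\<^sup>2 + 1) * T" using elim by (simp add: algebra_simps)
      finally show ?case .
    qed
    have "Z\<^sup>2 + 1 > 0" by (intro add_nonneg_pos) auto
    \<comment> \<open>One \<open>N\<close> serves both lines. Each complementary weight may cost
      \<open>\<epsilon> / 4 * T\<close>, which leaves \<open>\<epsilon> / 2 * T\<close> for the
      horizontal edges.\<close>
    from weight_error_small[OF G_cont _ bd_\<sigma>, of 0 "\<epsilon> / 4" k]
      weight_error_small[OF G_cont this bd_c, of 1 "\<epsilon> / 4" k] \<epsilon>
    have "\<forall>\<^sub>F N in sequentially.
       (\<forall>\<^sub>F T in at_top. norm (integral {1..T} (\<lambda>t. G (Complex \<sigma> t) *
           (1 - (1 - (Complex 0 t / (\<i> * of_real T)) ^ N) ^ k))) \<le> \<epsilon> / 4 * T) \<and>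
       (\<forall>\<^sub>F T in at_top. norm (integral {1..T} (\<lambda>t. G (Complex c t) *
           (1 - (1 - (Complex 1 t / (\<i> * of_real T)) ^ N) ^ k))) \<le> \<epsilon> / 4 * T)"
      by (simp add: eventually_conj_iff)
    from eventually_happens'[OF sequentially_bot this] obtain N where
      N\<sigma>: "\<forall>\<^sub>F T in at_top. norm (integral {1..T} (\<lambda>t. G (Complex \<sigma> t) *
           (1 - (1 - (Complex 0 t / (\<i> * of_real T)) ^ N) ^ k))) \<le> \<epsilon> / 4 * T" and
      Nc: "\<forall>\<^sub>F T in at_top. norm (integral {1..T} (\<lambda>t. G (Complex c t) *
           (1 - (1 - (Complex 1 t / (\<i> * of_real T)) ^ N) ^ k))) \<le> \<epsilon> / 4 * T"
      by blast
    \<comment> \<open>Bounds on the bottom and top edges; neither depends on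
      \<open>T\<close>.\<close>
    define B1 where "B1 = (K * (\<sigma> + 2)) ^ k * n * 2 ^ k"
    define B2 where "B2 = (K * (\<sigma> + 2)) ^ k * n * (real N * 2 ^ N) ^ k"
    have "\<forall>\<^sub>F T in at_top. (B1 + B2) * 1 \<le> \<epsilon> / 2 * T"
      using \<epsilon> by real_asymp
    \<comment> \<open>On the bottom edge \<open>|s - \<sigma>| \<le> 2\<close>, so
      \<open>T \<ge> 2\<close> ensures \<open>|u| \<le> 1\<close> there.\<close>
    with N\<sigma> Nc eventually_ge_at_top[of 2]
    have "\<forall>\<^sub>F T in at_top. norm (integral {1..T} (\<lambda>t. G (Complex \<sigma> t)) - integral {1..T} (\<lambda>t. G (Complex c t))) \<le> \<epsilon> * T"
    proof eventually_elim
      case (elim T)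
      define u where "u = (\<lambda>s. (s - of_real \<sigma>) / (\<i> * of_real T))"
      define W where "W = (\<lambda>s. (1 - u s ^ N) ^ k)"
      have u: "u (Complex x t) = Complex (x - \<sigma>) t / (\<i> * of_real T)" for x t
      proof -
        have "Complex x t - of_real \<sigma> = Complex (x - \<sigma>) t" by (simp add: complex_eq_iff)
        then show ?thesis by (simp only: u_def)
      qed
      have W_cont: "continuous_on S (\<lambda>t. W (Complex x t))" for x S
        unfolding W_def u_def Complex_eq using elim(3) by (intro continuous_intros) auto
      have split: "integral {1..T} (\<lambda>t. G (Complex x t)) = integral {1..T} (\<lambda>t. G (Complex x t) * W (Complex x t))
          + integral {1..T} (\<lambda>t. G (Complex x t) * (1 - W (Complex x t)))" for x
        by (subst integral_add [symmetric])
           (auto intro!: integrable_on_half_line continuous_intros G_cont W_cont simp: algebra_simps)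
      have "norm (integral {1..T} (\<lambda>t. G (Complex \<sigma> t) * W (Complex \<sigma> t)) -
          integral {1..T} (\<lambda>t. G (Complex c t) * W (Complex c t))) \<le> (B1 + B2) * (c - \<sigma>)"
      proof (rule vertical_line_shift[where F = "\<lambda>s. G s * W s"])
        show "(\<lambda>s. G s * W s) holomorphic_on {s. Re s > 0 \<and> Im s > 0}"
          unfolding G_def W_def u_def using elim(3)
          by (intro holomorphic_intros holomorphic_on_subset[OF holomorphic_zeta]) auto
      next
        fix x assume x: "x \<in> {\<sigma>..c}"
        have "norm (Complex (x - \<sigma>) 1) \<le> 2"
          using cmod_le[of "Complex (x - \<sigma>) 1"] x by (simp add: c_def)
        then have "norm (u (Complex x 1)) \<le> 1"
          using elim(3) by (simp add: u norm_divide norm_mult)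
        then have "norm (1 - u (Complex x 1) ^ N) \<le> 2"
          using norm_triangle_ineq4[of 1 "u (Complex x 1) ^ N"] power_le_one[of "norm (u (Complex x 1))" N]
          by (simp add: norm_power)
        then have "norm (W (Complex x 1)) \<le> 2 ^ k"
          unfolding W_def norm_power by (intro power_mono) auto
        with G_growth[OF x, of 1] show "norm (G (Complex x 1) * W (Complex x 1)) \<le> B1"
          unfolding norm_mult B1_def by (intro mult_mono) (use K(1) \<sigma> in auto)
      next
        fix x assume x: "x \<in> {\<sigma>..c}"
        have "norm (Complex (x - \<sigma>) T) \<le> 1 + T"
          using cmod_le[of "Complex (x - \<sigma>) T"] x elim(3) by (simp add: c_def)
        also have "\<dots> \<le> 2 * T" using elim(3) by simp
        finally have u2: "norm (u (Complex x T)) \<le> 2"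
          using elim(3) by (simp add: u norm_divide norm_mult field_simps)
        \<comment> \<open>At height \<open>T\<close> the argument \<open>u\<close> is within
          \<open>1 / T\<close> of 1, a zero of \<open>1 - u^N\<close>; this makes the
          \<open>k\<close>-th power in the weight as small as \<open>T^-k\<close>.\<close>
        have "1 - u (Complex x T) = \<i> * of_real ((x - \<sigma>) / T)"
          using elim(3) by (simp add: u_def Complex_eq field_simps)
        then have "norm (1 - u (Complex x T)) = (x - \<sigma>) / T"
          using x elim(3) by (simp only: norm_mult norm_ii norm_of_real) simp
        also have "\<dots> \<le> 1 / T" using x elim(3) by (intro divide_right_mono) (auto simp: c_def)
        finally have u1: "norm (1 - u (Complex x T)) \<le> 1 / T" .
        have "norm (1 - u (Complex x T) ^ N) \<le> norm (1 - u (Complex x T)) * (real N * 2 ^ N)"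
          by (rule norm_one_minus_power_le[OF u2]) simp
        also have "\<dots> \<le> 1 / T * (real N * 2 ^ N)" using u1 by (intro mult_right_mono) auto
        finally have "norm (W (Complex x T)) \<le> (1 / T * (real N * 2 ^ N)) ^ k"
          unfolding W_def norm_power by (intro power_mono) auto
        with G_growth[OF x, of T] elim(3)
        have "norm (G (Complex x T) * W (Complex x T)) \<le>
            ((K * (\<sigma> + 2) * T) ^ k * n) * (1 / T * (real N * 2 ^ N)) ^ k"
          unfolding norm_mult by (intro mult_mono) (use K(1) \<sigma> in auto)
        also have "\<dots> = B2"
          using elim(3) by (simp add: B2_def power_mult_distrib power_divide)
        finally show "norm (G (Complex x T) * W (Complex x T)) \<le> B2" .
      qed (use \<sigma> elim in \<open>auto simp: c_def\<close>)
      also have "\<dots> \<le> \<epsilon> / 2 * T" using elim(4) by (simp add: c_def)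
      finally have mid: "norm (integral {1..T} (\<lambda>t. G (Complex \<sigma> t) * W (Complex \<sigma> t)) -
          integral {1..T} (\<lambda>t. G (Complex c t) * W (Complex c t))) \<le> \<epsilon> / 2 * T" .
      have e\<sigma>: "norm (integral {1..T} (\<lambda>t. G (Complex \<sigma> t) * (1 - W (Complex \<sigma> t)))) \<le> \<epsilon> / 4 * T"
        using elim(1) by (simp add: W_def u)
      have ec: "norm (integral {1..T} (\<lambda>t. G (Complex c t) * (1 - W (Complex c t)))) \<le> \<epsilon> / 4 * T"
        using elim(2) by (simp add: W_def u c_def)
      have tri: "norm ((a + b) - (a' + b')) \<le> norm (a - a') + norm b + norm b'" for a b a' b' :: complex
        using norm_triangle_ineq[of "a - a'" "b - b'"] norm_triangle_ineq4[of b b']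
        by (simp add: algebra_simps)
      show ?case unfolding split
        by (rule order.trans[OF tri]) (use mid e\<sigma> ec in linarith)
    qed
    with mean_c show "\<exists>g. has_mean g (of_real (real (divisor_fun k n) * real n powr - \<sigma>)) \<and>
      (\<forall>\<^sub>F T in at_top. norm (integral {1..T} (\<lambda>t. G (Complex \<sigma> t)) - integral {1..T} g) \<le> \<epsilon> * T)"
      by blast
  qed
  then show ?thesis using G_line[of 0] n by simp
qed

section \<open>From mean values to Besicovitch approximation\<close>

lemma set_integral_half_line:
  fixes f :: "real \<Rightarrow> 'a :: euclidean_space"
  assumes "continuous_on {1..} f"
  shows "set_integrable lebesgue {1..T} f" "(LINT t:{1..T}|lebesgue. f t) = integral {1..T} f"
proof -
  have "continuous_on {1..T} f" by (rule continuous_on_subset[OF assms]) auto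
  then show "set_integrable lebesgue {1..T} f"
    using absolutely_integrable_continuous_real by blast
  then show "(LINT t:{1..T}|lebesgue. f t) = integral {1..T} f"
    by (rule set_lebesgue_integral_eq_integral)
qed

lemma trig_polynomial_sum:
  assumes "finite I"
  shows "trig_polynomial (\<lambda>t. \<Sum>j\<in>I. a j * exp (\<i> * of_real (w j * t)))"
proof -
  obtain h where h: "bij_betw h {..<card I} I"
    using ex_bij_betw_nat_finite[OF assms] by (auto simp: atLeast0LessThan)
  have "(\<lambda>t. \<Sum>j\<in>I. a j * exp (\<i> * of_real (w j * t))) =
      (\<lambda>t. \<Sum>i<card I. a (h i) * exp (\<i> * of_real (w (h i) * t)))"
    by (intro ext sum.reindex_bij_betw [OF h, symmetric])
  then show ?thesis unfolding trig_polynomial_def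
    by (intro exI[of _ "card I"] exI[of _ "a \<circ> h"] exI[of _ "w \<circ> h"]) (simp add: o_def)
qed

lemma bohr_trig_polynomial:
  assumes "trig_polynomial p"
  shows "bohr p"
  unfolding bohr_def
  by (rule exI[of _ "\<lambda>_. p"]) (use assms in \<open>auto simp: uniform_limit_iff\<close>)

lemma has_mean_of_real_iff:
  "has_mean (\<lambda>t. of_real (h t)) (of_real L) \<longleftrightarrow>
     continuous_on {1..} h \<and> ((\<lambda>T. integral {1..T} h / T) \<longlongrightarrow> L) at_top"
proof -
  have "continuous_on {1..} (\<lambda>t. complex_of_real (h t)) \<longleftrightarrow> continuous_on {1..} h"
    using continuous_on_Re[of "{1..}" "\<lambda>t. complex_of_real (h t)"] by (auto intro: continuous_on_of_real)
  moreover have "integral {1..T} (\<lambda>t. complex_of_real (h t)) / of_real T = of_real (integral {1..T} h / T)"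
    if "continuous_on {1..} h" for T
  proof -
    have "integral {1..T} (complex_of_real \<circ> h) = of_real (integral {1..T} h)"
      by (intro integral_linear integrable_on_half_line that bounded_linear_of_real)
    then show ?thesis by (simp add: o_def)
  qed
  ultimately show ?thesis
    unfolding has_mean_def by (auto simp: tendsto_of_real_iff simp del: of_real_divide)
qed

theorem lemma1:
  fixes k :: nat and \<sigma>k :: "nat \<Rightarrow> real" and \<sigma> :: real
  assumes "k \<ge> 1"
    and "critical_abscissae \<sigma>k"
    and "\<sigma> > \<sigma>k k"
  shows "(\<lambda>t. zeta (Complex \<sigma> t) ^ k) \<in> besicovitch2"
proof -
  define f where "f = (\<lambda>t. zeta (Complex \<sigma> t) ^ k)"
  define b where "b = (\<lambda>n. real (divisor_fun k n) * real n powr - \<sigma>)"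
  define L where "L = (\<Sum>n. real (divisor_fun k (Suc n)) ^ 2 / real (Suc n) powr (2 * \<sigma>))"
  define S where "S = (\<lambda>N. \<Sum>n<N. b (Suc n) ^ 2)"
  have f: "continuous_on {1..} f" unfolding f_def by (intro continuous_intros continuous_on_zeta_line)
  have f2: "continuous_on {1..} (\<lambda>t. norm (f t) ^ 2)" by (intro continuous_intros f)
  have "1 / 2 \<le> \<sigma>k k" using assms unfolding critical_abscissae_def by blast
  with assms(3) have \<sigma>: "\<sigma> > 0" by simp
  have lim: "((\<lambda>T. zeta_moment k \<sigma> T / T) \<longlongrightarrow> L) at_top"
    using assms unfolding critical_abscissae_def L_def by blast
  have moment: "zeta_moment k \<sigma> T = integral {1..T} (\<lambda>t. norm (f t) ^ 2)" for T
  proof -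
    have "zeta_moment k \<sigma> T = (LINT t:{1..T}|lebesgue. norm (f t) ^ 2)"
      unfolding zeta_moment_def f_def by (simp add: norm_power power_mult [symmetric] mult.commute)
    then show ?thesis by (simp only: set_integral_half_line(2)[OF f2])
  qed
  have mean_f2: "has_mean (\<lambda>t. of_real (norm (f t) ^ 2)) (of_real L)"
    unfolding has_mean_of_real_iff using f2 lim by (simp add: moment)
  \<comment> \<open>Convergence of the moments supplies the bounded mean square needed to compute
    the coefficients.\<close>
  have bd: "\<forall>\<^sub>F T in at_top. integral {1..T} (\<lambda>t. norm (zeta (Complex \<sigma> t) ^ k) ^ 2) \<le> (L + 1) * T"
    using order_tendstoD(2)[OF lim, of "L + 1", simplified] eventually_gt_at_top[of 0]
    by eventually_elim (simp add: moment f_def field_simps)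
  define P where "P = (\<lambda>N t. \<Sum>n<N. of_real (b (Suc n)) * exp (\<i> * of_real (- ln (real (Suc n)) * t)))"
  have mean_P: "((\<lambda>T. (LINT t:{1..T}|lebesgue. norm (f t - P N t) ^ 2) / T) \<longlongrightarrow> L - S N) at_top" for N
  proof -
    have coeff: "has_mean (\<lambda>t. f t * exp (\<i> * of_real (- (- ln (real (Suc n))) * t))) (of_real (b (Suc n)))" for n
      using has_mean_zeta_power[OF \<sigma> _ bd, of "Suc n"] unfolding f_def b_def by simp
    \<comment> \<open>The frequencies \<open>- ln (n + 1)\<close> are distinct because the logarithm
      is injective on positive numbers.\<close>
    have "has_mean (\<lambda>t. of_real (norm (f t - P N t) ^ 2)) (of_real L - (\<Sum>n<N. of_real (norm (complex_of_real (b (Suc n))) ^ 2)))"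
      unfolding P_def
      by (rule has_mean_norm_diff_trig_squared[OF _ _ f mean_f2 coeff]) (auto simp: inj_on_def simp del: of_nat_Suc)
    also have "of_real L - (\<Sum>n<N. of_real (norm (complex_of_real (b (Suc n))) ^ 2)) = (of_real (L - S N) :: complex)"
      by (simp add: S_def)
    finally show ?thesis
      unfolding has_mean_of_real_iff by (simp add: set_integral_half_line(2))
  qed
  \<comment> \<open>Bessel's inequality: \<open>L - S N\<close> is a limit of nonnegative
    means.\<close>
  have S_le: "S N \<le> L" for N
  proof -
    have "0 \<le> L - S N"
      by (rule tendsto_lowerbound[OF mean_P[of N]])
         (auto intro!: eventually_mono[OF eventually_gt_at_top[of 0]] divide_nonneg_pos
            simp: set_lebesgue_integral_def)
    then show ?thesis by simp
  qed
  \<comment> \<open>Bessel's inequality makes the series converge, so that \<open>L\<close> is its genuine sum.\<close>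
  have "summable (\<lambda>n. b (Suc n) ^ 2)"
    by (rule summableI_nonneg_bounded[where x = L]) (use S_le in \<open>auto simp: S_def\<close>)
  then have "S \<longlonglongrightarrow> (\<Sum>n. b (Suc n) ^ 2)"
    unfolding S_def by (rule summable_LIMSEQ)
  also have "(\<lambda>n. b (Suc n) ^ 2) = (\<lambda>n. real (divisor_fun k (Suc n)) ^ 2 / real (Suc n) powr (2 * \<sigma>))"
  proof
    fix n
    have "(real (Suc n) powr - \<sigma>)\<^sup>2 = real (Suc n) powr - (2 * \<sigma>)"
      unfolding power2_eq_square powr_add [symmetric] by simp
    then show "b (Suc n) ^ 2 = real (divisor_fun k (Suc n)) ^ 2 / real (Suc n) powr (2 * \<sigma>)"
      unfolding b_def power_mult_distrib by (simp add: powr_minus_divide del: of_nat_Suc)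
  qed
  finally have S_lim: "S \<longlonglongrightarrow> L" by (simp add: L_def)
  have "\<exists>g. bohr g \<and> Limsup at_top (\<lambda>T. ereal ((LINT t:{1..T}|lebesgue. norm (f t - g t) ^ 2) / T)) < ereal \<epsilon>"
    if \<epsilon>: "\<epsilon> > 0" for \<epsilon>
  proof -
    \<comment> \<open>The mean square distance from \<open>f\<close> to \<open>P N\<close> is
      \<open>L - S N\<close>, so this \<open>N\<close> achieves the accuracy
      \<open>\<epsilon>\<close>.\<close>
    obtain N where "L - \<epsilon> < S N"
      using eventually_happens'[OF sequentially_bot order_tendstoD(1)[OF S_lim, of "L - \<epsilon>"]] \<epsilon> by auto
    moreover have "Limsup at_top (\<lambda>T. ereal ((LINT t:{1..T}|lebesgue. norm (f t - P N t) ^ 2) / T)) = ereal (L - S N)"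
      using mean_P[of N] by (intro lim_imp_Limsup) auto
    moreover have "bohr (P N)"
      unfolding P_def by (intro bohr_trig_polynomial trig_polynomial_sum) auto
    ultimately show ?thesis by (intro exI[of _ "P N"]) auto
  qed
  moreover have "f \<in> L2_loc"
  proof -
    have "f \<in> borel_measurable (lebesgue_on {1..})"
      by (rule continuous_imp_measurable_on_sets_lebesgue[OF f]) auto
    then have "set_borel_measurable lebesgue {1..} f"
      by (simp add: set_borel_measurable_def borel_measurable_restrict_space_iff)
    then show ?thesis using set_integral_half_line(1)[OF f2] by (simp add: L2_loc_def)
  qed
  ultimately show ?thesis by (simp add: besicovitch2_def f_def)
qed

end
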